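(* Let $M$ be a closed connected smooth manifold of dimension $n\geqslant 2$ and $f\colon M\to\mathbb{R}$ a $C^1$-function all of whose critical points are isolated. Then the graph $\Gamma(f)\subset M$ is homotopy equivalent to the Reeb graph $\mathcal{R}(f)$.
   Context: "Smooth" means (at least) $C^1$. Write $\mathrm{Cr}(f)$ for the (finite) set of critical points, $M_c=f^{-1}(c)$, $M^{(c,c')}=\{x\in M: c<f(x)<c'\}$, $\mathrm{cl}$ for closure, $I=[0,1]$. Reeb graph: $\mathcal{R}(f)=M/\!\sim$, where $x\sim y$ iff $x,y$ lie in the same connected component of a level set $M_c$; it has the quotient topology and is (homeomorphic to) a finite graph whose vertices are the classes of the critical points. Essential component: a connected component of a level set $M_c$ that contains a critical point; it is denoted $M_c^{es}$. Component of type (IIa): for critical values $c<c'$, a connected component $C$ of $M^{(c,c')}$ that contains no critical point and whose closure $\mathrm{cl}(C)$ meets an essential component of $M_c$ and an essential component of $M_{c'}$ (these essential components are denoted $M_c^{es}$, $M_{c'}^{es}$ when $C$ is fixed). Decreasing edge-path of $C$: a path $\gamma\colon I\to M$ with $\gamma(0)\in M_{c'}^{es}$, $\gamma(1)\in M_c^{es}$, $\gamma((0,1))\subset C$, and $f(\gamma(t))<f(\gamma(t'))$ for $t>t'$. The graph $\Gamma(f)$: for each component $C$ of type (IIa) of $M^{(c,c')}$ choose critical points $x_c^C\in\mathrm{cl}(C)\cap M_c^{es}$ and $x_{c'}^C\in\mathrm{cl}(C)\cap M_{c'}^{es}$, to be joined by a decreasing edge-path of $C$. $\Gamma(f)\subset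 M$ is the 1-dimensional CW-complex with: (i) $0$-cells the critical points of $f$; (ii) $1$-cells the edges of a "spanning tree" $\Gamma_c^{es}\subset M_c^{es}$, one for every essential component of every level set, i.e. a closed subspace of $M_c^{es}$ homeomorphic to a tree with vertex set $M_c^{es}\cap\mathrm{Cr}(f)$; (iii) as additional $1$-cells, for every component $C$ of type (IIa) one decreasing edge-path $\gamma_C$ of $C$ joining the chosen critical points $x_{c'}^C$ and $x_c^C$. (Such trees and edge-paths exist.) *)

theory Defs
  imports "HOL-Analysis.Analysis"
begin

text \<open>
  A manifold is a topology \<open>X\<close> together with an atlas \<open>A\<close>, a set of charts \<open>(U, \<phi>)\<close>. The map \<open>\<phi>\<close> is
  only relevant on the domain \<open>U\<close>, and the model space is a Euclidean space \<open>'b\<close>, so that the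
  dimension of the manifold is \<open>DIM('b)\<close>.
\<close>

subsection \<open>Closed smooth manifolds\<close>

text \<open>Intended for open \<open>S\<close> only, the derivative being taken at \<open>x\<close> and not within \<open>S\<close>.\<close>

definition C1_on ::
  "'b::real_normed_vector set \<Rightarrow> ('b \<Rightarrow> 'c::real_normed_vector) \<Rightarrow> bool" where
  "C1_on S g \<longleftrightarrow>
     (\<exists>g' :: 'b \<Rightarrow> 'b \<Rightarrow>\<^sub>L 'c.
        (\<forall>x\<in>S. (g has_derivative blinfun_apply (g' x)) (at x)) \<and> continuous_on S g')"

definition chart :: "'a topology \<Rightarrow> 'a set \<Rightarrow> ('a \<Rightarrow> 'b::euclidean_space) \<Rightarrow> bool" where
  "chart X U \<phi> \<longleftrightarrow>
     openin X U \<and> open (\<phi> ` U) \<and> homeomorphic_map (subtopology X U) (top_of_set (\<phi> ` U)) \<phi>"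

definition C1_atlas :: "'a topology \<Rightarrow> ('a set \<times> ('a \<Rightarrow> 'b::euclidean_space)) set \<Rightarrow> bool" where
  "C1_atlas X A \<longleftrightarrow>
     (\<forall>(U, \<phi>)\<in>A. chart X U \<phi>) \<and>
     topspace X = (\<Union>(U, \<phi>)\<in>A. U) \<and>
     (\<forall>(U, \<phi>)\<in>A. \<forall>(V, \<psi>)\<in>A. C1_on (\<phi> ` (U \<inter> V)) (\<psi> \<circ> inv_into U \<phi>))"

definition closed_C1_manifold ::
  "'a topology \<Rightarrow> ('a set \<times> ('a \<Rightarrow> 'b::euclidean_space)) set \<Rightarrow> bool" where
  "closed_C1_manifold X A \<longleftrightarrow>
     Hausdorff_space X \<and> second_countable X \<and> compact_space X \<and> C1_atlas X A"

definition C1_function ::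
  "('a set \<times> ('a \<Rightarrow> 'b::euclidean_space)) set \<Rightarrow> ('a \<Rightarrow> real) \<Rightarrow> bool" where
  "C1_function A f \<longleftrightarrow> (\<forall>(U, \<phi>)\<in>A. C1_on (\<phi> ` U) (f \<circ> inv_into U \<phi>))"

text \<open>By the chain rule, vanishing of the differential does not depend on the chart around \<open>x\<close>.\<close>

definition Cr :: "('a set \<times> ('a \<Rightarrow> 'b::euclidean_space)) set \<Rightarrow> ('a \<Rightarrow> real) \<Rightarrow> 'a set" where
  "Cr A f =
     {x. \<exists>(U, \<phi>)\<in>A. x \<in> U \<and> ((f \<circ> inv_into U \<phi>) has_derivative (\<lambda>v. 0)) (at (\<phi> x))}"

definition isolated_critical_points ::
  "'a topology \<Rightarrow> ('a set \<times> ('a \<Rightarrow> 'b::euclidean_space)) set \<Rightarrow> ('a \<Rightarrow> real) \<Rightarrow> bool" where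
  "isolated_critical_points X A f \<longleftrightarrow> (\<forall>x\<in>Cr A f. \<exists>U. openin X U \<and> U \<inter> Cr A f = {x})"


subsection \<open>The Reeb graph\<close>

definition level :: "'a topology \<Rightarrow> ('a \<Rightarrow> real) \<Rightarrow> real \<Rightarrow> 'a set" where
  "level X f c = {x \<in> topspace X. f x = c}"

definition level_component :: "'a topology \<Rightarrow> ('a \<Rightarrow> real) \<Rightarrow> 'a \<Rightarrow> 'a set" where
  "level_component X f x = Collect (connected_component_of (subtopology X (level X f (f x))) x)"

text \<open>
  The points of the Reeb graph are the equivalence classes themselves, i.e. the connected
  components of the level sets, with the quotient topology along \<^term>\<open>level_component X f\<close>.
\<close>

definition reeb_graph :: "'a topology \<Rightarrow> ('a \<Rightarrow> real) \<Rightarrow> 'a set topology" where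
  "reeb_graph X f =
     topology (\<lambda>W. W \<subseteq> level_component X f ` topspace X \<and>
                   openin X {x \<in> topspace X. level_component X f x \<in> W})"

lemma openin_reeb_graph:
  "openin (reeb_graph X f) W \<longleftrightarrow>
     W \<subseteq> level_component X f ` topspace X \<and>
     openin X {x \<in> topspace X. level_component X f x \<in> W}"
proof -
  let ?q = "level_component X f"
  have "istopology (\<lambda>W. W \<subseteq> ?q ` topspace X \<and> openin X {x \<in> topspace X. ?q x \<in> W})"
    unfolding istopology_def
  proof (intro conjI allI impI)
    fix S T
    assume "S \<subseteq> ?q ` topspace X \<and> openin X {x \<in> topspace X. ?q x \<in> S}"
      and "T \<subseteq> ?q ` topspace X \<and> openin X {x \<in> topspace X. ?q x \<in> T}"
    moreover have "{x \<in> topspace X. ?q x \<in> S \<inter> T} =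
        {x \<in> topspace X. ?q x \<in> S} \<inter> {x \<in> topspace X. ?q x \<in> T}"
      by auto
    ultimately show "S \<inter> T \<subseteq> ?q ` topspace X"
      and "openin X {x \<in> topspace X. ?q x \<in> S \<inter> T}"
      by (auto simp del: Int_iff)
  next
    fix \<K>
    assume *: "\<forall>K\<in>\<K>. K \<subseteq> ?q ` topspace X \<and> openin X {x \<in> topspace X. ?q x \<in> K}"
    then show "\<Union>\<K> \<subseteq> ?q ` topspace X"
      by blast
    have "{x \<in> topspace X. ?q x \<in> \<Union>\<K>} = \<Union>((\<lambda>K. {x \<in> topspace X. ?q x \<in> K}) ` \<K>)"
      by auto
    then show "openin X {x \<in> topspace X. ?q x \<in> \<Union>\<K>}"
      using * by (simp only: ) (blast intro: openin_Union)
  qed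
  then show ?thesis
    by (simp add: reeb_graph_def topology_inverse')
qed

lemma topspace_reeb_graph: "topspace (reeb_graph X f) = level_component X f ` topspace X"
proof (rule antisym)
  show "topspace (reeb_graph X f) \<subseteq> level_component X f ` topspace X"
    using openin_topspace[of "reeb_graph X f"] by (simp only: openin_reeb_graph)
  have "{x \<in> topspace X. level_component X f x \<in> level_component X f ` topspace X} = topspace X"
    by auto
  then have "openin (reeb_graph X f) (level_component X f ` topspace X)"
    by (simp add: openin_reeb_graph)
  then show "level_component X f ` topspace X \<subseteq> topspace (reeb_graph X f)"
    by (rule openin_subset)
qed

lemma quotient_map_reeb_graph: "quotient_map X (reeb_graph X f) (level_component X f)"
  by (simp add: quotient_map_def topspace_reeb_graph openin_reeb_graph)


subsection \<open>Essential components and components of type (IIa)\<close>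

definition essential_components ::
  "'a topology \<Rightarrow> ('a set \<times> ('a \<Rightarrow> 'b::euclidean_space)) set \<Rightarrow> ('a \<Rightarrow> real) \<Rightarrow> real \<Rightarrow> 'a set set" where
  "essential_components X A f c =
     {K \<in> connected_components_of (subtopology X (level X f c)). K \<inter> Cr A f \<noteq> {}}"

definition slab :: "'a topology \<Rightarrow> ('a \<Rightarrow> real) \<Rightarrow> real \<Rightarrow> real \<Rightarrow> 'a set" where
  "slab X f c c' = {x \<in> topspace X. c < f x \<and> f x < c'}"

definition type_IIa ::
  "'a topology \<Rightarrow> ('a set \<times> ('a \<Rightarrow> 'b::euclidean_space)) set \<Rightarrow> ('a \<Rightarrow> real) \<Rightarrow>
     real \<Rightarrow> real \<Rightarrow> 'a set \<Rightarrow> bool" where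
  "type_IIa X A f c c' C \<longleftrightarrow>
     c \<in> f ` Cr A f \<and> c' \<in> f ` Cr A f \<and> c < c' \<and>
     C \<in> connected_components_of (subtopology X (slab X f c c')) \<and>
     C \<inter> Cr A f = {} \<and>
     (\<exists>K\<in>essential_components X A f c. (X closure_of C) \<inter> K \<noteq> {}) \<and>
     (\<exists>K'\<in>essential_components X A f c'. (X closure_of C) \<inter> K' \<noteq> {})"

text \<open>\<open>K\<close> and \<open>K'\<close> are the lower and upper essential components at which the path ends and starts.\<close>

definition decreasing_edge_path ::
  "'a topology \<Rightarrow> ('a \<Rightarrow> real) \<Rightarrow> 'a set \<Rightarrow> 'a set \<Rightarrow> 'a set \<Rightarrow> (real \<Rightarrow> 'a) \<Rightarrow> bool" where
  "decreasing_edge_path X f C K K' \<gamma> \<longleftrightarrow>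
     pathin X \<gamma> \<and> \<gamma> 0 \<in> K' \<and> \<gamma> 1 \<in> K \<and> \<gamma> ` {0<..<1} \<subseteq> C \<and>
     (\<forall>t\<in>{0..1}. \<forall>t'\<in>{0..1}. t > t' \<longrightarrow> f (\<gamma> t) < f (\<gamma> t'))"


subsection \<open>Finite trees and their geometric realizations\<close>

definition finite_tree :: "'a set \<Rightarrow> 'a set set \<Rightarrow> bool" where
  "finite_tree V E \<longleftrightarrow>
     finite V \<and> V \<noteq> {} \<and>
     (\<forall>e\<in>E. \<exists>u\<in>V. \<exists>v\<in>V. u \<noteq> v \<and> e = {u, v}) \<and>
     (\<forall>u\<in>V. \<forall>v\<in>V. (u, v) \<in> {(a, b). {a, b} \<in> E}\<^sup>*) \<and>
     \<not> (\<exists>p. length p \<ge> 3 \<and> distinct p \<and>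
            (\<forall>i. Suc i < length p \<longrightarrow> {p ! i, p ! Suc i} \<in> E) \<and> {last p, hd p} \<in> E)"

text \<open>Barycentric coordinates: \<open>V\<close> is realized by the unit vectors and \<open>e \<in> E\<close> by the segment
  joining its two endpoints.\<close>

definition realization_vertex :: "'a set \<Rightarrow> 'a \<Rightarrow> 'a \<Rightarrow> real" where
  "realization_vertex V v = (\<lambda>w\<in>V. if w = v then 1 else 0)"

definition graph_realization :: "'a set \<Rightarrow> 'a set set \<Rightarrow> ('a \<Rightarrow> real) topology" where
  "graph_realization V E =
     subtopology (powertop_real V)
       {x. (\<forall>w\<in>V. 0 \<le> x w) \<and> (\<Sum>w\<in>V. x w) = 1 \<and>
           ((\<exists>v\<in>V. {w\<in>V. x w \<noteq> 0} = {v}) \<or> {w\<in>V. x w \<noteq> 0} \<in> E)}"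

definition spanning_tree ::
  "'a topology \<Rightarrow> ('a set \<times> ('a \<Rightarrow> 'b::euclidean_space)) set \<Rightarrow> ('a \<Rightarrow> real) \<Rightarrow>
     'a set \<Rightarrow> 'a set \<Rightarrow> bool" where
  "spanning_tree X A f K T \<longleftrightarrow>
     closedin (subtopology X K) T \<and>
     (\<exists>E h. finite_tree (K \<inter> Cr A f) E \<and>
        homeomorphic_map (graph_realization (K \<inter> Cr A f) E) (subtopology X T) h \<and>
        (\<forall>v\<in>K \<inter> Cr A f. h (realization_vertex (K \<inter> Cr A f) v) = v))"


subsection \<open>The graph of critical points, spanning trees and edge-paths\<close>

text \<open>
  The graph depends on choices, so it is given by a predicate saying that the subset \<open>G\<close> of the
  manifold arises from some admissible choice of trees \<open>T\<close> and edge-paths \<open>\<gamma>\<close>. Essential components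
  of different levels are different, and a component of type (IIa) determines its two critical
  values, so \<open>T\<close> and \<open>\<gamma>\<close> need not be indexed by levels. As there are finitely many cells, the
  CW-topology is the subspace topology on \<open>G\<close>.
\<close>

definition is_Gamma ::
  "'a topology \<Rightarrow> ('a set \<times> ('a \<Rightarrow> 'b::euclidean_space)) set \<Rightarrow> ('a \<Rightarrow> real) \<Rightarrow> 'a set \<Rightarrow> bool" where
  "is_Gamma X A f G \<longleftrightarrow>
     (\<exists>T \<gamma>.
        (\<forall>c. \<forall>K\<in>essential_components X A f c. spanning_tree X A f K (T K)) \<and>
        (\<forall>c c' C. type_IIa X A f c c' C \<longrightarrow>
           (\<exists>K\<in>essential_components X A f c. \<exists>K'\<in>essential_components X A f c'.
              decreasing_edge_path X f C K K' (\<gamma> C) \<and>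
              \<gamma> C 0 \<in> Cr A f \<inter> (X closure_of C) \<inter> K' \<and>
              \<gamma> C 1 \<in> Cr A f \<inter> (X closure_of C) \<inter> K)) \<and>
        G = Cr A f \<union>
            (\<Union>c. \<Union>K\<in>essential_components X A f c. T K) \<union>
            \<Union>{\<gamma> C ` {0..1} | c c' C. type_IIa X A f c c' C})"

end

theory Submission
  imports Defs
begin

text \<open>
  Let \<open>q\<close> be the map of \<open>X\<close> onto the Reeb graph. The idea is that \<open>q\<close> restricted to \<open>G\<close> does nothing
  but collapse every spanning tree to a point, and that collapsing disjoint contractible
  subcomplexes of a graph is a homotopy equivalence.

  The first half rests on one geometric fact: a component \<open>C\<close> of type (IIa) meets every level
  between its two ends in a single level component, so that \<open>q\<close> maps an edge-path of \<open>C\<close>, along which \<open>f\<close> is strictly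
  monotone, bijectively to an open edge of the Reeb graph. The gradient of a
  \<open>C\<^sup>1\<close> function is only continuous and need not generate a flow. Its role is taken by the
  inverse function theorem, which provides around a noncritical point arbitrarily small neighbourhoods whose slices by the levels are connected
  (\<open>regular_point_noncritical\<close>). By compactness, finitely many of these combine to a \<^emph>\<open>tube\<close> around a
  level component without critical points: a connected open set that contains exactly one component
  of every nearby level (\<open>local_tube\<close>). Two tubes that meet agree over their common levels, hence
  they can be glued, and there is a largest tube through each point that does not lie
  in an essential component. Its frontier consists of points of essential
  components at its two extreme levels (\<open>edge_frontier\<close>), since at any other point it could be prolonged.
  This identifies the largest tubes with the components of type (IIa) (\<open>type_IIa_edge\<close>,
  \<open>type_IIa_is_edge\<close>), and shows that \<open>X\<close> is partitioned into finitely many essential components and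
  finitely many components of type (IIa).

  The Reeb graph is Hausdorff, because in a compact Hausdorff space components and quasi-components
  coincide (\<open>Hausdorff_reeb_graph\<close>). As \<open>G\<close> is compact, \<open>q\<close> restricted to \<open>G\<close> is therefore a quotient
  map; its fibres are the trees and single points.

  For the second half, a finite tree is contractible by removing leaves one at a time
  (\<open>contractible_graph_realization\<close>). Contractions of all the trees are extended over the arcs to a
  homotopy of \<open>G\<close> that maps each tree into itself and ends with a map that is constant on
  each tree (\<open>collapse_homotopy\<close>). The final map factors through the Reeb graph and the homotopy
  descends to it, so this factor is a homotopy inverse of \<open>q\<close>
  (\<open>homotopy_equivalent_space_quotient\<close>).
\<close>

section \<open>Regular points\<close>

text \<open>
  The purely topological content of \<open>df x \<noteq> 0\<close> that the rest of the proof relies on: near \<open>x\<close> the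
  function \<open>f\<close> is an open map with connected fibres, on arbitrarily small neighbourhoods.
\<close>

definition regular_point :: "'a topology \<Rightarrow> ('a \<Rightarrow> real) \<Rightarrow> 'a \<Rightarrow> bool" where
  "regular_point X f x \<longleftrightarrow>
     (\<forall>N. openin X N \<and> x \<in> N \<longrightarrow>
        (\<exists>B. openin X B \<and> x \<in> B \<and> B \<subseteq> N \<and> open (f ` B) \<and> (\<forall>s. connectedin X {y \<in> B. f y = s})))"

text \<open>
  Correcting the identity in a direction \<open>v\<close> with \<open>dg v = 1\<close> gives a map \<open>h\<close> whose coordinate along \<open>v\<close> is
  the function \<open>g\<close> itself. It is a local homeomorphism, and the preimage of a ball is
  the required set, since the slices of a ball by hyperplanes are convex.
\<close>

lemma regular_point_euclidean:
  fixes g :: "'b::euclidean_space \<Rightarrow> real" and g' :: "'b \<Rightarrow> 'b \<Rightarrow>\<^sub>L real"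
  assumes "open N" "p \<in> N"
    and der: "\<And>y. y \<in> N \<Longrightarrow> (g has_derivative blinfun_apply (g' y)) (at y)"
    and cont: "continuous_on N g'"
    and nz: "g' p \<noteq> 0"
  obtains B where "open B" "p \<in> B" "B \<subseteq> N" "open (g ` B)" "\<And>s. connected {y \<in> B. g y = s}"
proof -
  obtain v0 where v0: "blinfun_apply (g' p) v0 \<noteq> 0"
    using nz by (metis blinfun_eqI zero_blinfun.rep_eq)
  define v where "v = v0 /\<^sub>R blinfun_apply (g' p) v0"
  have Dv: "blinfun_apply (g' p) v = 1"
    using v0 by (simp add: v_def blinfun.scaleR_right)
  then have "v \<noteq> 0" by (metis blinfun.zero_right zero_neq_one)
  define w where "w = v /\<^sub>R (v \<bullet> v)"
  have wv: "w \<bullet> v = 1" using \<open>v \<noteq> 0\<close> by (simp add: w_def)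
  define h where "h = (\<lambda>y. y + (g y - w \<bullet> y) *\<^sub>R v)"
  define h' where "h' = (\<lambda>y. id_blinfun + (blinfun_scaleR_left v o\<^sub>L (g' y - blinfun_inner_right w)))"
  have h'_app: "blinfun_apply (h' y) u = u + (blinfun_apply (g' y) u - w \<bullet> u) *\<^sub>R v" for y u
    by (simp add: h'_def blinfun.add_left blinfun.diff_left)
  have derh: "(h has_derivative blinfun_apply (h' y)) (at y)" if "y \<in> N" for y
    unfolding h_def h'_app[abs_def]
    by (rule derivative_eq_intros der[OF that] refl | simp add: algebra_simps)+
  have conth: "continuous_on N h'"
    unfolding h'_def by (intro continuous_intros cont)
  \<comment> \<open>the inverse of \<open>h' p\<close>, which is the identity plus a map of rank one\<close>
  define invf where "invf = id_blinfun + (blinfun_scaleR_left v o\<^sub>L (blinfun_inner_right w - g' p))"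
  have inv: "invf o\<^sub>L h' p = id_blinfun"
    by (rule blinfun_eqI)
      (simp add: invf_def h'_app blinfun.add_left blinfun.diff_left blinfun.add_right blinfun.diff_right
         blinfun.scaleR_right Dv wv inner_simps algebra_simps)
  have wh: "w \<bullet> h y = g y" for y
    by (simp add: h_def inner_simps wv)
  obtain U V k k' where U: "open U" "U \<subseteq> N" "p \<in> U" and V: "open V" "h p \<in> V"
    and hom: "homeomorphism U V h k"
    using inverse_function_theorem[OF \<open>open N\<close> derh conth \<open>p \<in> N\<close> inv] by metis
  obtain e where "e > 0" and e: "ball (h p) e \<subseteq> V"
    using V openE by blast
  define B where "B = k ` ball (h p) e"
  have homB: "homeomorphism B (ball (h p) e) h k"
    using hom e unfolding B_def
    by (smt (verit) homeomorphism_def homeomorphism_of_subsets homeomorphism_image2 image_mono order_refl)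
  have "B \<subseteq> U" using e hom by (auto simp: B_def homeomorphism_def)
  have "openin (top_of_set U) B"
    unfolding B_def
  proof (rule homeomorphism_imp_open_map[OF homeomorphism_symD[OF hom]])
    show "openin (top_of_set V) (ball (h p) e)" using e by (simp add: open_subset)
  qed
  then have opB: "open B" using U openin_open_trans by blast
  have pB: "p \<in> B" using \<open>e > 0\<close> hom U unfolding B_def homeomorphism_def by (metis centre_in_ball image_eqI)
  have hB: "h ` B = ball (h p) e" and kB: "k ` ball (h p) e = B"
    and hk: "\<And>z. z \<in> ball (h p) e \<Longrightarrow> h (k z) = z"
    using homB by (auto simp: homeomorphism_def)
  have gB: "g ` B = (\<lambda>z. w \<bullet> z) ` ball (h p) e"
    unfolding hB[symmetric] image_image wh ..
  have op: "open (g ` B)"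
    unfolding gB
  proof (rule open_surjective_linear_image)
    show "linear ((\<bullet>) w)" by (simp add: bounded_linear.linear bounded_linear_inner_right)
    show "surj ((\<bullet>) w)"
      by (rule surjI[of _ "\<lambda>r. r *\<^sub>R v"]) (simp add: wv)
  qed auto
  have con: "connected {y \<in> B. g y = s}" for s
  proof -
    have gk: "g (k z) = w \<bullet> z" if "z \<in> ball (h p) e" for z
      using hk[OF that] wh[of "k z"] by simp
    have "{y \<in> B. g y = s} = k ` (ball (h p) e \<inter> {z. w \<bullet> z = s})"
      unfolding kB[symmetric] using gk by (auto simp del: mem_ball)
    moreover have "connected (ball (h p) e \<inter> {z. w \<bullet> z = s})"
      by (intro convex_connected convex_Int convex_ball convex_hyperplane)
    moreover have "continuous_on (ball (h p) e \<inter> {z. w \<bullet> z = s}) k"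
      using homB by (meson continuous_on_subset homeomorphism_cont2 inf_le1)
    ultimately show ?thesis by (simp add: connected_continuous_image)
  qed
  show thesis using that opB pB \<open>B \<subseteq> U\<close> U op con by (meson subset_trans)
qed

lemma chart_inverse:
  assumes "chart X U \<phi>"
  shows "continuous_map (subtopology X U) (top_of_set (\<phi> ` U)) \<phi>"
    and "continuous_map (top_of_set (\<phi> ` U)) (subtopology X U) (inv_into U \<phi>)"
    and "inj_on \<phi> U"
    and "\<And>W. openin X W \<Longrightarrow> W \<subseteq> U \<Longrightarrow> open (\<phi> ` W)"
    and "\<And>W. open W \<Longrightarrow> W \<subseteq> \<phi> ` U \<Longrightarrow> openin X (inv_into U \<phi> ` W)"
proof -
  have U: "openin X U" "open (\<phi> ` U)" and hom: "homeomorphic_map (subtopology X U) (top_of_set (\<phi> ` U)) \<phi>"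
    using assms by (auto simp: chart_def)
  have ts: "topspace (subtopology X U) = U" using U openin_subset by fastforce
  show 1: "continuous_map (subtopology X U) (top_of_set (\<phi> ` U)) \<phi>"
    using hom by (simp add: homeomorphic_imp_continuous_map)
  show inj: "inj_on \<phi> U" using hom ts by (metis homeomorphic_imp_injective_map)
  obtain k where k: "homeomorphic_maps (subtopology X U) (top_of_set (\<phi> ` U)) \<phi> k"
    using hom homeomorphic_map_maps by blast
  have keq: "k y = inv_into U \<phi> y" if "y \<in> \<phi> ` U" for y
    using k that inj ts unfolding homeomorphic_maps_def by (metis imageE inv_into_f_f)
  have "continuous_map (top_of_set (\<phi> ` U)) (subtopology X U) k"
    using k homeomorphic_maps_def by blast
  then show 2: "continuous_map (top_of_set (\<phi> ` U)) (subtopology X U) (inv_into U \<phi>)"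
    by (rule continuous_map_eq) (simp add: keq)
  show "open (\<phi> ` W)" if "openin X W" "W \<subseteq> U" for W
  proof -
    have "openin (subtopology X U) W" using that U by (simp add: openin_open_subtopology)
    then have "openin (top_of_set (\<phi> ` U)) (\<phi> ` W)"
      using hom homeomorphic_map_openness_eq by (metis)
    then show ?thesis using U openin_open_trans by blast
  qed
  show "openin X (inv_into U \<phi> ` W)" if "open W" "W \<subseteq> \<phi> ` U" for W
  proof -
    have "inv_into U \<phi> ` W = {x \<in> topspace (subtopology X U). \<phi> x \<in> W}"
      using that inj ts by (auto simp: inv_into_f_f image_iff subset_iff inv_into_into) (metis inv_into_f_f)
    moreover have "openin (subtopology X U) {x \<in> topspace (subtopology X U). \<phi> x \<in> W}"
      using 1 that by (intro openin_continuous_map_preimage[OF 1]) (simp add: open_subset)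
    ultimately show ?thesis using U by (metis openin_open_subtopology)
  qed
qed

lemma continuous_map_C1_function:
  fixes A :: "('a set \<times> ('a \<Rightarrow> 'b::euclidean_space)) set"
  assumes "C1_atlas X A" "C1_function A f"
  shows "continuous_map X euclideanreal f"
proof (rule pasting_lemma[where I=A and T=fst and f = "\<lambda>_. f"])
  fix a assume "a \<in> A"
  then obtain U \<phi> where a: "a = (U,\<phi>)" "(U,\<phi>) \<in> A" by (metis surj_pair)
  then have ch: "chart X U \<phi>" using assms by (auto simp: C1_atlas_def)
  show "openin X (fst a)" using ch a by (simp add: chart_def)
  have "C1_on (\<phi> ` U) (f \<circ> inv_into U \<phi>)" using assms a by (auto simp: C1_function_def)
  then have "continuous_on (\<phi> ` U) (f \<circ> inv_into U \<phi>)"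
    unfolding C1_on_def
    by (meson continuous_at_imp_continuous_on has_derivative_continuous)
  then have "continuous_map (subtopology X U) euclideanreal ((f \<circ> inv_into U \<phi>) \<circ> \<phi>)"
    by (intro continuous_map_compose[OF chart_inverse(1)[OF ch]]) simp
  then show "continuous_map (subtopology X (fst a)) euclideanreal f"
    unfolding a fst_conv by (rule continuous_map_eq) (use chart_inverse(3)[OF ch] in auto)
qed (use assms in \<open>auto simp: C1_atlas_def\<close>)

text \<open>
  Being critical can be tested in any chart, by the chain rule for the change of charts. This is
  what makes the set of critical points closed, and hence, if they are isolated, finite.
\<close>

lemma Cr_iff_chart:
  fixes A :: "('a set \<times> ('a \<Rightarrow> 'b::euclidean_space)) set"
  assumes at: "C1_atlas X A" and "(U,\<phi>) \<in> A" "x \<in> U"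
  shows "x \<in> Cr A f \<longleftrightarrow> ((f \<circ> inv_into U \<phi>) has_derivative (\<lambda>v. 0)) (at (\<phi> x))"
proof
  assume "x \<in> Cr A f"
  then obtain V \<psi> where V: "(V,\<psi>) \<in> A" "x \<in> V"
    and D: "((f \<circ> inv_into V \<psi>) has_derivative (\<lambda>v. 0)) (at (\<psi> x))"
    by (auto simp: Cr_def)
  have chU: "chart X U \<phi>" and chV: "chart X V \<psi>" using at V assms by (auto simp: C1_atlas_def)
  have "C1_on (\<phi> ` (U \<inter> V)) (\<psi> \<circ> inv_into U \<phi>)" using at V assms by (auto simp: C1_atlas_def)
  then obtain T where T: "((\<psi> \<circ> inv_into U \<phi>) has_derivative T) (at (\<phi> x))"
    using V assms unfolding C1_on_def by blast
  have ix: "inv_into U \<phi> (\<phi> x) = x" using chart_inverse(3)[OF chU] \<open>x \<in> U\<close> by simp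
  have "((f \<circ> inv_into V \<psi>) \<circ> (\<psi> \<circ> inv_into U \<phi>) has_derivative (\<lambda>v. 0) \<circ> T) (at (\<phi> x))"
    by (rule diff_chain_at[OF T]) (simp add: ix D)
  then have "((f \<circ> inv_into V \<psi>) \<circ> (\<psi> \<circ> inv_into U \<phi>) has_derivative (\<lambda>v. 0)) (at (\<phi> x))"
    by (simp add: o_def)
  then show "((f \<circ> inv_into U \<phi>) has_derivative (\<lambda>v. 0)) (at (\<phi> x))"
  proof (rule has_derivative_transform_within_open)
    show "open (\<phi> ` (U \<inter> V))"
      using chU chV by (intro chart_inverse(4)[OF chU]) (auto simp: chart_def)
    show "\<phi> x \<in> \<phi> ` (U \<inter> V)" using V \<open>x \<in> U\<close> by blast
    show "((f \<circ> inv_into V \<psi>) \<circ> (\<psi> \<circ> inv_into U \<phi>)) y = (f \<circ> inv_into U \<phi>) y"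
      if "y \<in> \<phi> ` (U \<inter> V)" for y
      using that chart_inverse(3)[OF chU] chart_inverse(3)[OF chV] by auto
  qed
qed (use assms in \<open>auto simp: Cr_def\<close>)

lemma regular_point_noncritical:
  fixes A :: "('a set \<times> ('a \<Rightarrow> 'b::euclidean_space)) set"
  assumes at: "C1_atlas X A" and f: "C1_function A f" and x: "x \<in> topspace X" "x \<notin> Cr A f"
  shows "regular_point X f x"
  unfolding regular_point_def
proof (intro allI impI)
  fix N assume N: "openin X N \<and> x \<in> N"
  obtain U \<phi> where U: "(U,\<phi>) \<in> A" "x \<in> U" using at x by (auto simp: C1_atlas_def)
  have ch: "chart X U \<phi>" using at U by (auto simp: C1_atlas_def)
  have "C1_on (\<phi> ` U) (f \<circ> inv_into U \<phi>)" using f U by (auto simp: C1_function_def)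
  then obtain g' where g': "\<And>y. y \<in> \<phi> ` U \<Longrightarrow> ((f \<circ> inv_into U \<phi>) has_derivative blinfun_apply (g' y)) (at y)"
      "continuous_on (\<phi> ` U) g'"
    by (auto simp: C1_on_def)
  have "g' (\<phi> x) \<noteq> 0"
  proof
    assume "g' (\<phi> x) = 0"
    then have "((f \<circ> inv_into U \<phi>) has_derivative (\<lambda>v. 0)) (at (\<phi> x))"
      using g'(1)[of "\<phi> x"] U by (simp add: zero_blinfun.rep_eq)
    then show False using x Cr_iff_chart[OF at U] by blast
  qed
  note nz = this
  have op: "open (\<phi> ` (U \<inter> N))"
    using N ch by (intro chart_inverse(4)[OF ch]) (auto simp: chart_def)
  have cont: "continuous_on (\<phi> ` (U \<inter> N)) g'"
    using g'(2) by (rule continuous_on_subset) auto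
  have der: "((f \<circ> inv_into U \<phi>) has_derivative blinfun_apply (g' y)) (at y)"
    if "y \<in> \<phi> ` (U \<inter> N)" for y
    using g'(1) that by blast
  have \<phi>x: "\<phi> x \<in> \<phi> ` (U \<inter> N)"
    using U N by blast
  obtain B where B: "open B" "\<phi> x \<in> B" "B \<subseteq> \<phi> ` (U \<inter> N)"
      "open ((f \<circ> inv_into U \<phi>) ` B)" "\<And>s. connected {y \<in> B. (f \<circ> inv_into U \<phi>) y = s}"
    proof (rule regular_point_euclidean[OF op \<phi>x _ cont nz])
    show "((f \<circ> inv_into U \<phi>) has_derivative blinfun_apply (g' y)) (at y)"
      if "y \<in> \<phi> ` (U \<inter> N)" for y by (rule der[OF that])
  qed (rule that)
  have inj: "inj_on \<phi> U" and BU: "B \<subseteq> \<phi> ` U" using chart_inverse(3)[OF ch] B by auto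
  let ?k = "inv_into U \<phi>"
  show "\<exists>B. openin X B \<and> x \<in> B \<and> B \<subseteq> N \<and> open (f ` B) \<and> (\<forall>s. connectedin X {y \<in> B. f y = s})"
  proof (intro exI conjI allI)
    show "openin X (?k ` B)" by (rule chart_inverse(5)[OF ch B(1) BU])
    show "x \<in> ?k ` B" using B(2) inj U by (metis imageI inv_into_f_f)
    show "?k ` B \<subseteq> N" using B(3) inj by force
    show "open (f ` ?k ` B)" using B(4) by (simp add: image_comp)
    fix s
    have eq: "{y \<in> ?k ` B. f y = s} = ?k ` {y \<in> B. (f \<circ> ?k) y = s}" by auto
    have "connectedin (top_of_set (\<phi> ` U)) {y \<in> B. (f \<circ> ?k) y = s}"
      using B(5) BU by (auto simp: connectedin_subtopology)
    then have "connectedin (subtopology X U) (?k ` {y \<in> B. (f \<circ> ?k) y = s})"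
      by (rule connectedin_continuous_map_image[OF chart_inverse(2)[OF ch]])
    then show "connectedin X {y \<in> ?k ` B. f y = s}"
      unfolding eq by (simp add: connectedin_subtopology)
  qed
qed

lemma closedin_Cr:
  fixes A :: "('a set \<times> ('a \<Rightarrow> 'b::euclidean_space)) set"
  assumes at: "C1_atlas X A" and f: "C1_function A f"
  shows "closedin X (Cr A f)"
proof -
  have "openin X (topspace X - Cr A f)"
  proof (subst openin_subopen, intro ballI)
    fix x assume x: "x \<in> topspace X - Cr A f"
    obtain U \<phi> where U: "(U,\<phi>) \<in> A" "x \<in> U" using at x by (auto simp: C1_atlas_def)
    have ch: "chart X U \<phi>" using at U by (auto simp: C1_atlas_def)
    have "C1_on (\<phi> ` U) (f \<circ> inv_into U \<phi>)" using f U by (auto simp: C1_function_def)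
    then obtain g' where g': "\<And>y. y \<in> \<phi> ` U \<Longrightarrow> ((f \<circ> inv_into U \<phi>) has_derivative blinfun_apply (g' y)) (at y)"
        "continuous_on (\<phi> ` U) g'"
      by (auto simp: C1_on_def)
    have crit: "y \<in> Cr A f \<longleftrightarrow> g' (\<phi> y) = 0" if "y \<in> U" for y
    proof -
      have "g' (\<phi> y) = 0 \<longleftrightarrow> blinfun_apply (g' (\<phi> y)) = (\<lambda>v. 0)"
        by (auto simp: zero_blinfun.rep_eq intro!: blinfun_eqI)
      then show ?thesis
        using Cr_iff_chart[OF at U(1) that, of f] g'(1)[OF imageI[OF that]]
        by (auto dest: has_derivative_unique)
    qed
    have U': "openin X U" "open (\<phi> ` U)" using ch by (auto simp: chart_def)
    have "open (\<phi> ` U \<inter> g' -` (- {0}))"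
      by (rule continuous_open_preimage[OF g'(2) U'(2)]) auto
    then have op: "openin X (inv_into U \<phi> ` (\<phi> ` U \<inter> g' -` (- {0})))"
      by (intro chart_inverse(5)[OF ch]) auto
    have "x \<in> inv_into U \<phi> ` (\<phi> ` U \<inter> g' -` (- {0}))"
      using x U crit[OF U(2)] chart_inverse(3)[OF ch]
      by (intro image_eqI[of _ _ "\<phi> x"]) auto
    moreover have "inv_into U \<phi> ` (\<phi> ` U \<inter> g' -` (- {0})) \<subseteq> topspace X - Cr A f"
      using crit chart_inverse(3)[OF ch] openin_subset[OF U'(1)] by auto
    ultimately show "\<exists>T. openin X T \<and> x \<in> T \<and> T \<subseteq> topspace X - Cr A f" using op by blast
  qed
  moreover have "Cr A f \<subseteq> topspace X" using at by (force simp: Cr_def C1_atlas_def)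
  ultimately show ?thesis by (simp add: closedin_def)
qed

lemma finite_Cr:
  fixes A :: "('a set \<times> ('a \<Rightarrow> 'b::euclidean_space)) set"
  assumes "compact_space X" "C1_atlas X A" "C1_function A f" "isolated_critical_points X A f"
  shows "finite (Cr A f)"
proof -
  have "compactin X (Cr A f)" using assms closedin_Cr closedin_compact_space by blast
  moreover obtain U where U: "\<And>x. x \<in> Cr A f \<Longrightarrow> openin X (U x) \<and> U x \<inter> Cr A f = {x}"
    using assms(4) unfolding isolated_critical_points_def by metis
  ultimately have cp: "compactin X (Cr A f)" and U: "\<And>x. x \<in> Cr A f \<Longrightarrow> openin X (U x)"
      "\<And>x. x \<in> Cr A f \<Longrightarrow> U x \<inter> Cr A f = {x}" by auto
  have "(\<forall>W\<in>U ` Cr A f. openin X W) \<and> Cr A f \<subseteq> \<Union>(U ` Cr A f)"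
    using U by blast
  then obtain \<F> where "finite \<F>" "\<F> \<subseteq> U ` Cr A f" "Cr A f \<subseteq> \<Union>\<F>"
    using cp unfolding compactin_def by meson
  then obtain P where P: "finite P" "P \<subseteq> Cr A f" "Cr A f \<subseteq> \<Union>(U ` P)"
    by (metis finite_subset_image)
  have "Cr A f \<subseteq> P"
  proof
    fix x assume "x \<in> Cr A f"
    then obtain y where "y \<in> P" "x \<in> U y" using P by blast
    moreover have "U y \<inter> Cr A f = {y}" using U(2) P(2) \<open>y \<in> P\<close> by (meson subsetD)
    ultimately show "x \<in> P" using \<open>x \<in> Cr A f\<close> by auto
  qed
  then show ?thesis using P finite_subset by blast
qed

section \<open>Level components\<close>

text \<open>
  The form in which connectedness is exploited throughout: the set \<open>V\<close> need not be the complement of \<open>W\<close>,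
  it only has to take care of the points of \<open>D\<close> outside \<open>W\<close>.
\<close>

lemma connectedin_subset_clopen:
  assumes "connectedin X D" "openin X W" "openin X V" "D \<subseteq> W \<union> V" "W \<inter> V \<inter> D = {}" "D \<inter> W \<noteq> {}"
  shows "D \<subseteq> W"
proof -
  have "V \<inter> D = {}"
    using assms unfolding connectedin by blast
  then show ?thesis using assms(4) by blast
qed

lemma in_level_component: "x \<in> topspace X \<Longrightarrow> x \<in> level_component X f x"
  by (simp add: level_component_def connected_component_of_refl level_def)

lemma level_component_subset: "level_component X f x \<subseteq> level X f (f x)"
  using connected_component_of_subset_topspace[of "subtopology X (level X f (f x))" x]
  by (auto simp: level_component_def)

lemma connectedin_level_component: "connectedin X (level_component X f x)"
  using connectedin_connected_component_of[of "subtopology X (level X f (f x))" x]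
  unfolding level_component_def by (simp add: connectedin_subtopology)

lemma level_component_maximal:
  assumes "connectedin X D" "x \<in> D" "\<And>y. y \<in> D \<Longrightarrow> f y = f x"
  shows "D \<subseteq> level_component X f x"
proof -
  have "D \<subseteq> level X f (f x)"
    unfolding level_def using assms(3) connectedin_subset_topspace[OF assms(1)] by blast
  then show ?thesis
    unfolding level_component_def using assms(1,2)
    by (intro connected_component_of_maximal) (auto simp: connectedin_subtopology)
qed

lemma level_component_eq:
  assumes "y \<in> level_component X f x"
  shows "level_component X f y = level_component X f x"
proof -
  have "f y = f x" using assms level_component_subset by (fastforce simp: level_def)
  then show ?thesis
    using assms unfolding level_component_def
    by (metis connected_component_of_equiv mem_Collect_eq)
qed

text \<open>
  All that remains of the smooth structure in the arguments below.
\<close>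

locale finite_critical =
  fixes X :: "'a topology" and A :: "('a set \<times> ('a \<Rightarrow> 'b::euclidean_space)) set" and f :: "'a \<Rightarrow> real"
  assumes hausdorff: "Hausdorff_space X"
    and compact: "compact_space X"
    and cont: "continuous_map X euclideanreal f"
    and crit_subset: "Cr A f \<subseteq> topspace X"
    and finite_crit: "finite (Cr A f)"
    and regular: "\<And>x. x \<in> topspace X - Cr A f \<Longrightarrow> regular_point X f x"
begin

abbreviation lc where "lc \<equiv> level_component X f"

lemma lc_sub: "y \<in> lc x \<Longrightarrow> y \<in> topspace X \<and> f y = f x"
  using level_component_subset[of X f x] by (auto simp: level_def)

lemma open_vimage: "open J \<Longrightarrow> openin X {x \<in> topspace X. f x \<in> J}"
  using openin_continuous_map_preimage[OF cont] by simp

lemma closed_level: "closedin X (level X f t)"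
proof -
  have "closedin X {x \<in> topspace X. f x \<in> {t}}"
    by (rule closedin_continuous_map_preimage[OF cont]) simp
  then show ?thesis by (simp add: level_def)
qed

lemma closed_lc: "closedin X (lc x)"
  unfolding level_component_def
  by (rule closedin_trans_full[OF closedin_connected_component_of closed_level])

text \<open>
  Levels depend upper semicontinuously on the value, as the continuous image of the compact
  complement of \<open>V\<close> is closed.
\<close>

lemma eventually_level_subset:
  assumes "openin X V" "level X f t \<subseteq> V"
  shows "\<forall>\<^sub>F s in nhds t. level X f s \<subseteq> V"
proof -
  have "compactin X (topspace X - V)"
    using assms compact by (simp add: closedin_compact_space openin_closedin_eq)
  then have "compact (f ` (topspace X - V))"
    using cont image_compactin by fastforce
  then have "open (- f ` (topspace X - V))" by (simp add: compact_imp_closed open_Compl)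
  moreover have "t \<in> - f ` (topspace X - V)" using assms by (auto simp: level_def)
  ultimately show ?thesis
    unfolding eventually_nhds by (intro exI[of _ "- f ` (topspace X - V)"]) (auto simp: level_def)
qed

lemma open_image:
  assumes "openin X V" "V \<inter> Cr A f = {}"
  shows "open (f ` V)"
proof (subst open_subopen, intro ballI)
  fix t assume "t \<in> f ` V"
  then obtain x where x: "x \<in> V" "t = f x" by blast
  then have "regular_point X f x"
    using assms openin_subset by (intro regular) blast
  then obtain B where "openin X B" "x \<in> B" "B \<subseteq> V" "open (f ` B)"
    unfolding regular_point_def using assms x by metis
  then show "\<exists>T. open T \<and> t \<in> T \<and> T \<subseteq> f ` V" using x by (intro exI[of _ "f ` B"]) auto
qed

text \<open>
  A tube contains precisely one component of each level that it meets. The openness of the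
  complement over \<open>f ` W\<close> says that no point outside \<open>W\<close> at such a level is a limit of points of
  \<open>W\<close>; it forces \<open>W\<close> to contain the level component of each of its points, and it is what makes
  tubes over the same levels coincide as soon as they meet.
\<close>

definition tube :: "'a set \<Rightarrow> bool" where
  "tube W \<longleftrightarrow> openin X W \<and> W \<inter> Cr A f = {} \<and> connectedin X W \<and>
     openin X ({x \<in> topspace X. f x \<in> f ` W} - W) \<and>
     (\<forall>x\<in>W. \<forall>y\<in>W. f y = f x \<longrightarrow> y \<in> lc x)"

lemma tube_lc:
  assumes "tube W" "x \<in> W"
  shows "lc x \<subseteq> W"
proof (rule connectedin_subset_clopen[OF connectedin_level_component])
  show "openin X W" "openin X ({x \<in> topspace X. f x \<in> f ` W} - W)" using assms by (auto simp: tube_def)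
  show "lc x \<subseteq> W \<union> ({x \<in> topspace X. f x \<in> f ` W} - W)" using lc_sub assms by fastforce
  have "x \<in> topspace X" using assms openin_subset by (auto simp: tube_def)
  then show "lc x \<inter> W \<noteq> {}" using in_level_component assms by fastforce
qed auto

text \<open>
  If two open sets separated \<open>W\<close>, then, fibres being connected, their images under the open map \<open>f\<close>
  would separate the connected set \<open>f ` W\<close>.
\<close>

lemma connectedin_fibres:
  assumes W: "openin X W" "W \<inter> Cr A f = {}" "connected (f ` W)"
    and fib: "\<And>x y. x \<in> W \<Longrightarrow> y \<in> W \<Longrightarrow> f y = f x \<Longrightarrow> y \<in> lc x" "\<And>x. x \<in> W \<Longrightarrow> lc x \<subseteq> W"
  shows "connectedin X W"
  unfolding connectedin
proof (intro conjI notI)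
  show "W \<subseteq> topspace X" using W openin_subset by blast
  assume "\<exists>E1 E2. openin X E1 \<and> openin X E2 \<and> W \<subseteq> E1 \<union> E2 \<and> E1 \<inter> E2 \<inter> W = {} \<and> E1 \<inter> W \<noteq> {} \<and> E2 \<inter> W \<noteq> {}"
  then obtain E F where E: "openin X E" "openin X F" "W \<subseteq> E \<union> F" "E \<inter> F \<inter> W = {}" "E \<inter> W \<noteq> {}" "F \<inter> W \<noteq> {}"
    by blast
  have "open (f ` (E \<inter> W))" "open (f ` (F \<inter> W))"
    using E W by (auto intro!: open_image)
  moreover have "f ` W = f ` (E \<inter> W) \<union> f ` (F \<inter> W)" using E by blast
  moreover have "f ` (E \<inter> W) \<inter> f ` (F \<inter> W) = {}"
  proof (rule ccontr)
    assume "f ` (E \<inter> W) \<inter> f ` (F \<inter> W) \<noteq> {}"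
    then obtain x y where xy: "x \<in> E" "x \<in> W" "y \<in> F" "y \<in> W" "f y = f x" by (auto; metis)
    have "lc x \<subseteq> E"
    proof (rule connectedin_subset_clopen[OF connectedin_level_component E(1,2)])
      show "lc x \<subseteq> E \<union> F" "E \<inter> F \<inter> lc x = {}" using fib(2)[OF xy(2)] E by blast+
      show "lc x \<inter> E \<noteq> {}" using xy E(1) in_level_component openin_subset by fastforce
    qed
    then show False using fib(1)[OF xy(2,4,5)] xy E(4) by blast
  qed
  ultimately show False
    using W(3) E(5,6) connectedD[OF W(3), of "f ` (E \<inter> W)" "f ` (F \<inter> W)"] by blast
qed

text \<open>
  Let \<open>L\<close> be the component of the level of \<open>x\<close> that contains \<open>x\<close>. It is open in its level, since
  around regular points levels are locally connected. Thus \<open>L\<close> and the rest of the level have disjoint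
  neighbourhoods \<open>N\<close> and \<open>N'\<close>, and \<open>L\<close> is covered by finitely many boxes \<open>B p\<close> inside \<open>N\<close> with connected
  slices. The tube is the part of the union of the boxes over a short interval of values. Its slices are
  connected because two boxes that overlap in \<open>L\<close> still overlap in all nearby levels: a
  separation of a nearby slice would sort the boxes into two classes and so separate \<open>L\<close>.
\<close>

lemma local_tube:
  assumes x: "x \<in> topspace X" and nocrit: "lc x \<inter> Cr A f = {}"
  shows "\<exists>W. tube W \<and> x \<in> W"
proof -
  define L t where "L = lc x" and "t = f x"
  have Lsub: "L \<subseteq> level X f t" and connL: "connectedin X L" and clL: "closedin X L" and xL: "x \<in> L"
    unfolding L_def t_def
    by (fact level_component_subset connectedin_level_component closed_lc in_level_component[OF x])+
  have Ltop: "L \<subseteq> topspace X" using clL closedin_subset by blast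
  have box: "\<exists>B. openin X B \<and> y \<in> B \<and> B \<subseteq> N \<and> B \<inter> Cr A f = {} \<and> (\<forall>s. connectedin X {z \<in> B. f z = s})"
    if "y \<in> L" "openin X N" "y \<in> N" for y N
  proof -
    have "openin X (N - Cr A f)" "y \<in> N - Cr A f"
      using that nocrit closedin_Hausdorff_finite[OF hausdorff crit_subset finite_crit]
      by (auto simp: L_def)
    moreover have "regular_point X f y" using that nocrit Ltop by (intro regular) (auto simp: L_def)
    ultimately obtain B where "openin X B" "y \<in> B" "B \<subseteq> N - Cr A f" "\<forall>s. connectedin X {z \<in> B. f z = s}"
      unfolding regular_point_def by meson
    then show ?thesis by blast
  qed
  have box_sub: "{z \<in> B. f z = t} \<subseteq> L" if "y \<in> L" "y \<in> B" "\<forall>s. connectedin X {z \<in> B. f z = s}" for y B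
  proof -
    have "f y = t" using that Lsub by (auto simp: level_def)
    then have "{z \<in> B. f z = t} \<subseteq> lc y" using that by (intro level_component_maximal) auto
    also have "lc y = L" using that(1) unfolding L_def by (rule level_component_eq)
    finally show ?thesis .
  qed
  \<comment> \<open>\<open>L\<close> is open in its level\<close>
  have "\<exists>O'. openin X O' \<and> O' \<inter> level X f t = L"
  proof -
    have "\<exists>B. openin X B \<and> y \<in> B \<and> {z \<in> B. f z = t} \<subseteq> L" if y: "y \<in> L" for y
    proof -
      obtain B where "openin X B" "y \<in> B" "\<forall>s. connectedin X {z \<in> B. f z = s}"
        using box[OF y openin_topspace] y Ltop by blast
      then show ?thesis using box_sub[OF y] by blast
    qed
    then obtain B where B: "\<And>y. y \<in> L \<Longrightarrow> openin X (B y) \<and> y \<in> B y \<and> {z \<in> B y. f z = t} \<subseteq> L" by metis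
    have "(\<Union>y\<in>L. B y) \<inter> level X f t = L" using B Lsub by (auto simp: level_def)
    moreover have "openin X (\<Union>y\<in>L. B y)" using B by blast
    ultimately show ?thesis by blast
  qed
  then obtain O' where O': "openin X O'" "O' \<inter> level X f t = L" by blast
  have "closedin X (level X f t - L)"
  proof -
    have "level X f t - L = level X f t - O'" using O' by blast
    then show ?thesis using closed_level O' by auto
  qed
  moreover have "normal_space X" using compact hausdorff compact_Hausdorff_or_regular_imp_normal_space by blast
  ultimately obtain N N' where N: "openin X N" "openin X N'" "L \<subseteq> N" "level X f t - L \<subseteq> N'" "disjnt N N'"
    unfolding normal_space_def using clL by (metis disjnt_def Diff_disjoint)
  have "\<forall>y\<in>L. \<exists>B. openin X B \<and> y \<in> B \<and> B \<subseteq> N \<and> B \<inter> Cr A f = {} \<and> (\<forall>s. connectedin X {z \<in> B. f z = s})"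
    using box N by blast
  from bchoice[OF this] obtain B where "\<forall>y\<in>L. openin X (B y) \<and> y \<in> B y \<and> B y \<subseteq> N \<and>
      B y \<inter> Cr A f = {} \<and> (\<forall>s. connectedin X {z \<in> B y. f z = s})" ..
  then have B: "\<And>y. y \<in> L \<Longrightarrow> openin X (B y)" "\<And>y. y \<in> L \<Longrightarrow> y \<in> B y" "\<And>y. y \<in> L \<Longrightarrow> B y \<subseteq> N"
      "\<And>y. y \<in> L \<Longrightarrow> B y \<inter> Cr A f = {}" "\<And>y s. y \<in> L \<Longrightarrow> connectedin X {z \<in> B y. f z = s}"
    by auto
  have "compactin X L" using clL compact closedin_compact_space by blast
  moreover have "(\<forall>V\<in>B ` L. openin X V) \<and> L \<subseteq> \<Union>(B ` L)" using B by blast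
  ultimately obtain \<F> where "finite \<F>" "\<F> \<subseteq> B ` L" "L \<subseteq> \<Union>\<F>" unfolding compactin_def by meson
  then obtain P where P: "finite P" "P \<subseteq> L" "L \<subseteq> \<Union>(B ` P)" by (metis finite_subset_image)
  have Pne: "P \<noteq> {}" using P(3) xL by auto
  note BP = B[OF subsetD[OF P(2)]]
  let ?V = "\<Union>(B ` P)"
  have opV: "openin X ?V" using BP(1) by blast
  \<comment> \<open>the interval of values: nearby levels stay in \<open>?V \<union> N'\<close>, and overlaps of boxes persist\<close>
  have "\<forall>\<^sub>F s in nhds t. level X f s \<subseteq> ?V \<union> N'"
    using opV N P(3) by (intro eventually_level_subset) blast+
  moreover have "\<forall>\<^sub>F s in nhds t. \<forall>p\<in>P. \<forall>q\<in>P. B p \<inter> B q \<inter> L \<noteq> {} \<longrightarrow> s \<in> f ` (B p \<inter> B q)"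
  proof (intro eventually_ball_finite[OF \<open>finite P\<close>] ballI)
    fix p q assume pq: "p \<in> P" "q \<in> P"
    show "\<forall>\<^sub>F s in nhds t. B p \<inter> B q \<inter> L \<noteq> {} \<longrightarrow> s \<in> f ` (B p \<inter> B q)"
    proof (cases "B p \<inter> B q \<inter> L = {}")
      case False
      have "open (f ` (B p \<inter> B q))" using pq BP(1,4) by (intro open_image openin_Int) blast+
      moreover have "t \<in> f ` (B p \<inter> B q)" using False Lsub by (fastforce simp: level_def)
      ultimately show ?thesis by (intro eventually_mono[OF eventually_nhds_in_open]) auto
    qed auto
  qed
  ultimately have "\<forall>\<^sub>F s in nhds t. level X f s \<subseteq> ?V \<union> N' \<and>
      (\<forall>p\<in>P. \<forall>q\<in>P. B p \<inter> B q \<inter> L \<noteq> {} \<longrightarrow> s \<in> f ` (B p \<inter> B q))"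
    by (rule eventually_conj)
  then obtain e where e: "e > 0" and "\<forall>s. dist s t < e \<longrightarrow> level X f s \<subseteq> ?V \<union> N' \<and>
      (\<forall>p\<in>P. \<forall>q\<in>P. B p \<inter> B q \<inter> L \<noteq> {} \<longrightarrow> s \<in> f ` (B p \<inter> B q))"
    unfolding eventually_nhds_metric by blast
  then have lev: "\<And>s. dist s t < e \<Longrightarrow> level X f s \<subseteq> ?V \<union> N'"
    and ov: "\<And>s p q. dist s t < e \<Longrightarrow> p \<in> P \<Longrightarrow> q \<in> P \<Longrightarrow> B p \<inter> B q \<inter> L \<noteq> {} \<Longrightarrow> s \<in> f ` (B p \<inter> B q)"
    by simp_all
  define W where "W = {y \<in> ?V. dist (f y) t < e}"
  have opball: "open {s. dist s t < e}"
    using open_ball[of t e] by (simp add: ball_def dist_commute)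
  have opE: "openin X {y \<in> topspace X. dist (f y) t < e}"
    using open_vimage[OF opball] by simp
  have Vtop: "?V \<subseteq> topspace X" using opV openin_subset by blast
  have VN: "?V \<subseteq> N" using BP(3) by blast
  have W_eq: "W = ?V \<inter> {y \<in> topspace X. dist (f y) t < e}" using Vtop by (auto simp: W_def)
  have opW: "openin X W" unfolding W_eq using opV opE by blast
  have Wcr: "W \<inter> Cr A f = {}" using BP(4) by (auto simp: W_def)
  have fibre_ne: "{y \<in> B p. f y = s} \<noteq> {}" if "p \<in> P" "dist s t < e" for p s
  proof -
    have "B p \<inter> B p \<inter> L \<noteq> {}" using that(1) P(2) BP(2) by blast
    then show ?thesis using ov[OF that(2,1,1)] by blast
  qed
  have fW: "f ` W = {s. dist s t < e}"
  proof
    show "{s. dist s t < e} \<subseteq> f ` W"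
    proof
      fix s assume "s \<in> {s. dist s t < e}"
      moreover obtain p where "p \<in> P" using Pne by blast
      ultimately show "s \<in> f ` W" using fibre_ne[of p s] by (auto simp: W_def image_iff)
    qed
  qed (auto simp: W_def)
  have clW: "openin X ({y \<in> topspace X. f y \<in> f ` W} - W)"
  proof -
    have "{y \<in> topspace X. f y \<in> f ` W} - W = N' \<inter> {y \<in> topspace X. dist (f y) t < e}" (is "?l = ?r")
    proof
      show "?l \<subseteq> ?r"
      proof
        fix y assume y: "y \<in> ?l"
        then have "dist (f y) t < e" "y \<in> topspace X" by (auto simp: fW)
        then have "y \<in> ?V \<union> N'" using lev[of "f y"] by (auto simp: level_def)
        then show "y \<in> ?r" using y \<open>dist (f y) t < e\<close> by (auto simp: W_def)
      qed
      show "?r \<subseteq> ?l" unfolding fW using VN N(5) by (auto simp: W_def disjnt_def)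
    qed
    then show ?thesis using N(2) opE by auto
  qed
  have conn_fib: "connectedin X {y \<in> W. f y = s}" if s: "dist s t < e" for s
    unfolding connectedin
  proof (intro conjI notI)
    show "{y \<in> W. f y = s} \<subseteq> topspace X" using Vtop by (auto simp: W_def)
    assume "\<exists>E1 E2. openin X E1 \<and> openin X E2 \<and> {y \<in> W. f y = s} \<subseteq> E1 \<union> E2 \<and>
       E1 \<inter> E2 \<inter> {y \<in> W. f y = s} = {} \<and> E1 \<inter> {y \<in> W. f y = s} \<noteq> {} \<and> E2 \<inter> {y \<in> W. f y = s} \<noteq> {}"
    then obtain E F where E: "openin X E" "openin X F" "{y \<in> W. f y = s} \<subseteq> E \<union> F"
       "E \<inter> F \<inter> {y \<in> W. f y = s} = {}" "E \<inter> {y \<in> W. f y = s} \<noteq> {}" "F \<inter> {y \<in> W. f y = s} \<noteq> {}"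
      by blast
    have Ws: "{y \<in> W. f y = s} = (\<Union>p\<in>P. {y \<in> B p. f y = s})" using s by (auto simp: W_def)
    have dich: "{y \<in> B p. f y = s} \<subseteq> E \<or> {y \<in> B p. f y = s} \<subseteq> F" if "p \<in> P" for p
    proof -
      have "{y \<in> B p. f y = s} \<subseteq> {y \<in> W. f y = s}" using Ws that by blast
      then have *: "{y \<in> B p. f y = s} \<subseteq> E \<union> F" "E \<inter> F \<inter> {y \<in> B p. f y = s} = {}" using E by blast+
      have conn_p: "connectedin X {y \<in> B p. f y = s}" using BP(5) that by blast
      have "{y \<in> B p. f y = s} \<subseteq> E" if "{y \<in> B p. f y = s} \<inter> E \<noteq> {}"
        by (rule connectedin_subset_clopen[OF _ E(1,2) *]) (use that conn_p in blast)+
      then show ?thesis using *(1) by blast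
    qed
    \<comment> \<open>a separation of the slice at level \<open>s\<close> sorts the boxes into two classes\<close>
    define PE PF where "PE = {p \<in> P. {y \<in> B p. f y = s} \<subseteq> E}" and "PF = {p \<in> P. {y \<in> B p. f y = s} \<subseteq> F}"
    have PEF: "P \<subseteq> PE \<union> PF" using dich by (auto simp: PE_def PF_def)
    have cover: "L \<subseteq> \<Union>(B ` PE) \<union> \<Union>(B ` PF)" using P PEF by blast
    have disj: "\<Union>(B ` PE) \<inter> \<Union>(B ` PF) \<inter> L = {}"
    proof (rule ccontr)
      assume "\<Union>(B ` PE) \<inter> \<Union>(B ` PF) \<inter> L \<noteq> {}"
      then obtain p q where pq: "p \<in> PE" "q \<in> PF" "B p \<inter> B q \<inter> L \<noteq> {}" by blast
      then have "s \<in> f ` (B p \<inter> B q)" using ov[OF s] by (simp add: PE_def PF_def)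
      then obtain y where "y \<in> B p" "y \<in> B q" "f y = s" by blast
      then have "y \<in> E \<inter> F \<inter> {y \<in> W. f y = s}"
        using pq Ws by (auto simp: PE_def PF_def)
      then show False using E by blast
    qed
    have meetE: "PE \<noteq> {}"
    proof
      assume "PE = {}"
      then have "P \<subseteq> PF" using PEF by blast
      then have "{y \<in> W. f y = s} \<subseteq> F" unfolding Ws PF_def by blast
      then show False using E by blast
    qed
    have meetF: "PF \<noteq> {}"
    proof
      assume "PF = {}"
      then have "P \<subseteq> PE" using PEF by blast
      then have "{y \<in> W. f y = s} \<subseteq> E" unfolding Ws PE_def by blast
      then show False using E by blast
    qed
    have "openin X (\<Union>(B ` PE))" "openin X (\<Union>(B ` PF))"
      using BP(1) by (auto simp: PE_def PF_def)
    moreover have "\<Union>(B ` Q) \<inter> L \<noteq> {}" if Q: "Q \<noteq> {}" "Q \<subseteq> P" for Q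
    proof -
      obtain q where "q \<in> Q" using Q(1) by blast
      then have "q \<in> B q \<inter> L" using BP(2)[of q] P(2) Q(2) by blast
      then show ?thesis using \<open>q \<in> Q\<close> by blast
    qed
    then have "\<Union>(B ` PE) \<inter> L \<noteq> {}" "\<Union>(B ` PF) \<inter> L \<noteq> {}"
      using meetE meetF by (auto simp: PE_def PF_def)
    note PEF_facts = calculation this
    have "L \<subseteq> \<Union>(B ` PE)"
      by (rule connectedin_subset_clopen[OF connL PEF_facts(1,2) cover disj])
        (use PEF_facts(3) in blast)
    then show False
      using disj PEF_facts(4) by blast
  qed
  have fib: "z \<in> lc y" if "y \<in> W" "z \<in> W" "f z = f y" for y z
  proof -
    have "{u \<in> W. f u = f y} \<subseteq> lc y"
      using that conn_fib[of "f y"] by (intro level_component_maximal) (auto simp: W_def)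
    then show ?thesis using that by blast
  qed
  have lcW: "lc y \<subseteq> W" if "y \<in> W" for y
  proof (rule connectedin_subset_clopen[OF connectedin_level_component opW clW])
    show "lc y \<subseteq> W \<union> ({x \<in> topspace X. f x \<in> f ` W} - W)" using lc_sub that by fastforce
    show "lc y \<inter> W \<noteq> {}" using in_level_component[of y X f] that Vtop by (auto simp: W_def)
  qed auto
  have "connected (f ` W)"
    using connected_ball[of t e] by (simp add: fW ball_def dist_commute)
  then have "connectedin X W" by (intro connectedin_fibres opW Wcr fib lcW)
  then have "tube W" using opW Wcr clW fib by (auto simp: tube_def)
  moreover have "x \<in> W" using xL P e by (auto simp: W_def t_def)
  ultimately show ?thesis by blast
qed

section \<open>Maximal tubes and components of type (IIa)\<close>

text \<open>
  Over the common interval \<open>I\<close> of values, the part of \<open>W\<close> is connected and \<open>W'\<close> is relatively clopen.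
\<close>

lemma tube_fibre_subset:
  assumes W: "tube W" and W': "tube W'" and meet: "x \<in> W" "x \<in> W'"
    and y: "y \<in> W" "f y \<in> f ` W'"
  shows "y \<in> W'"
proof -
  define I where "I = f ` W \<inter> f ` W'"
  define P where "P = {z \<in> W. f z \<in> I}"
  have op: "openin X W" "openin X W'" and cr: "W \<inter> Cr A f = {}" "W' \<inter> Cr A f = {}"
    and conn: "connectedin X W" "connectedin X W'"
    using W W' by (auto simp: tube_def)
  have "connected (f ` W)" "connected (f ` W')"
    using conn connectedin_continuous_map_image[OF cont] by auto
  then have connI: "connected I"
    unfolding I_def by (metis is_interval_Int is_interval_connected_1)
  have "open I" unfolding I_def using op cr by (intro open_Int open_image)
  have P_eq: "P = W \<inter> {z \<in> topspace X. f z \<in> I}" using openin_subset[OF op(1)] by (auto simp: P_def)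
  have fP: "f ` P = I" by (auto simp: P_def I_def)
  have "connectedin X P"
  proof (rule connectedin_fibres)
    show "openin X P" unfolding P_eq using op(1) open_vimage[OF \<open>open I\<close>] by blast
    show "P \<inter> Cr A f = {}" using cr by (auto simp: P_def)
    show "connected (f ` P)" using connI fP by simp
    show "v \<in> lc u" if "u \<in> P" "v \<in> P" "f v = f u" for u v
      using that W by (auto simp: P_def tube_def)
    show "lc u \<subseteq> P" if "u \<in> P" for u
      using that tube_lc[OF W, of u] lc_sub by (force simp: P_def)
  qed
  moreover have "openin X ({z \<in> topspace X. f z \<in> f ` W'} - W')" using W' by (simp add: tube_def)
  moreover have "P \<subseteq> W' \<union> ({z \<in> topspace X. f z \<in> f ` W'} - W')"
    using openin_subset[OF op(1)] by (auto simp: P_def I_def)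
  moreover have "P \<inter> W' \<noteq> {}" using meet by (auto simp: P_def I_def)
  ultimately have "P \<subseteq> W'" using op(2) by (intro connectedin_subset_clopen[of X P W' "{z \<in> topspace X. f z \<in> f ` W'} - W'"]) blast+
  then show ?thesis using y by (auto simp: P_def I_def)
qed

lemma tube_Union:
  assumes tubes: "\<And>W. W \<in> \<W> \<Longrightarrow> tube W"
    and meet: "\<And>V W. V \<in> \<W> \<Longrightarrow> W \<in> \<W> \<Longrightarrow> V \<inter> W \<noteq> {}"
    and conn: "connectedin X (\<Union>\<W>)"
  shows "tube (\<Union>\<W>)"
  unfolding tube_def
proof (intro conjI ballI impI)
  have into: "y \<in> W" if "V \<in> \<W>" "W \<in> \<W>" "y \<in> V" "f y \<in> f ` W" for V W y
    using meet[OF that(1,2)] tube_fibre_subset[OF tubes[OF that(1)] tubes[OF that(2)]] that(3,4) by blast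
  show "openin X (\<Union>\<W>)" using tubes by (auto simp: tube_def)
  show "\<Union>\<W> \<inter> Cr A f = {}" using tubes by (auto simp: tube_def)
  show "connectedin X (\<Union>\<W>)" by (fact conn)
  have "{x \<in> topspace X. f x \<in> f ` \<Union>\<W>} - \<Union>\<W> = (\<Union>W\<in>\<W>. {x \<in> topspace X. f x \<in> f ` W} - W)"
    using into by blast
  moreover have "openin X (\<Union>W\<in>\<W>. {x \<in> topspace X. f x \<in> f ` W} - W)"
    using tubes by (auto simp: tube_def)
  ultimately show "openin X ({x \<in> topspace X. f x \<in> f ` \<Union>\<W>} - \<Union>\<W>)" by simp
  fix x y assume "x \<in> \<Union>\<W>" "y \<in> \<Union>\<W>" and eq: "f y = f x"
  then obtain V W where VW: "V \<in> \<W>" "x \<in> V" "W \<in> \<W>" "y \<in> W" by blast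
  then have "f y \<in> f ` V" using eq by auto
  then have "y \<in> V" using into VW by blast
  then show "y \<in> lc x" using tubes[OF VW(1)] VW(2) eq by (auto simp: tube_def)
qed

text \<open>
  The largest tube through \<open>x\<close>, and the empty set if the level component of \<open>x\<close> is essential. In
  the first case its image in the Reeb graph is an open edge.
\<close>

definition edge :: "'a \<Rightarrow> 'a set" where
  "edge x = \<Union>{W. tube W \<and> x \<in> W}"

lemma tube_edge:
  assumes "x \<in> topspace X" "lc x \<inter> Cr A f = {}"
  shows "tube (edge x)" and "x \<in> edge x"
proof -
  show x: "x \<in> edge x" using local_tube[OF assms] by (auto simp: edge_def)
  have "connectedin X (edge x)"
    unfolding edge_def
    by (rule connectedin_Union) (auto simp: tube_def)
  then show "tube (edge x)"
    unfolding edge_def by (intro tube_Union) auto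
qed

text \<open>
  A frontier point whose level component had no critical point would lie in a tube of its own, and
  gluing that tube to \<open>edge x\<close> would contradict maximality.
\<close>

lemma edge_frontier:
  assumes x: "x \<in> topspace X" "lc x \<inter> Cr A f = {}" and z: "z \<in> X closure_of edge x" "z \<notin> edge x"
  shows "f z \<notin> f ` edge x" and "lc z \<inter> Cr A f \<noteq> {}"
proof -
  note T = tube_edge[OF x]
  have ztop: "z \<in> topspace X" using z closure_of_subset_topspace by fastforce
  show "f z \<notin> f ` edge x"
  proof
    assume "f z \<in> f ` edge x"
    then have "z \<in> {y \<in> topspace X. f y \<in> f ` edge x} - edge x" using z ztop by blast
    moreover have "openin X ({y \<in> topspace X. f y \<in> f ` edge x} - edge x)"
      using T by (simp add: tube_def)
    note openin_Int_closure_of_eq_empty[OF this, of "edge x"]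
    ultimately show False using z(1) by blast
  qed
  show "lc z \<inter> Cr A f \<noteq> {}"
  proof
    assume "lc z \<inter> Cr A f = {}"
    then obtain V where V: "tube V" "z \<in> V" using local_tube ztop by blast
    then have "openin X V" by (simp add: tube_def)
    then have meet: "V \<inter> edge x \<noteq> {}"
      using z(1) V(2) openin_Int_closure_of_eq_empty[of X V "edge x"] by blast
    have "tube (\<Union>{V, edge x})"
    proof (rule tube_Union)
      show "connectedin X (\<Union>{V, edge x})"
        using V T(1) meet by (simp add: tube_def connectedin_Un)
      show "U \<inter> W \<noteq> {}" if "U \<in> {V, edge x}" "W \<in> {V, edge x}" for U W
        using that meet T(2) V(2) by blast
    qed (use V T in auto)
    moreover have "x \<in> \<Union>{V, edge x}" using T(2) by simp
    ultimately have "\<Union>{V, edge x} \<subseteq> edge x" unfolding edge_def[of x] by (intro Union_upper CollectI conjI)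
    then show False using V z by blast
  qed
qed

lemma edge_unique:
  assumes x: "x \<in> topspace X" "lc x \<inter> Cr A f = {}" and y: "y \<in> edge x"
  shows "edge y = edge x"
proof -
  note T = tube_edge[OF x]
  have "y \<in> topspace X" using T(1) y openin_subset by (auto simp: tube_def)
  moreover have "lc y \<inter> Cr A f = {}" using tube_lc[OF T(1) y] T(1) by (auto simp: tube_def)
  ultimately have Ty: "tube (edge y)" "y \<in> edge y" by (rule tube_edge)+
  have xy: "edge x \<subseteq> edge y" unfolding edge_def[of y] by (intro Union_upper CollectI conjI T(1) y)
  moreover have "edge y \<subseteq> edge x" unfolding edge_def[of x]
    by (intro Union_upper CollectI conjI Ty(1) subsetD[OF xy T(2)])
  ultimately show ?thesis by blast
qed

lemma edge_interval:
  assumes x: "x \<in> topspace X" "lc x \<inter> Cr A f = {}"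
  obtains c c' where "c < c'" "f ` edge x = {c<..<c'}"
    "\<And>b. b \<in> {c, c'} \<Longrightarrow> \<exists>z \<in> X closure_of edge x. f z = b \<and> lc z \<inter> Cr A f \<noteq> {}"
proof -
  note T = tube_edge[OF x]
  define J where "J = f ` edge x"
  have Esub: "edge x \<subseteq> topspace X" using T(1) openin_subset by (auto simp: tube_def)
  have "open J" unfolding J_def using T by (intro open_image) (auto simp: tube_def)
  have "connected J" unfolding J_def
    using T(1) connectedin_continuous_map_image[OF cont] by (auto simp: tube_def)
  have cpt: "compactin X (X closure_of edge x)" using compact by (simp add: closedin_compact_space)
  then have comp: "compact (f ` (X closure_of edge x))" using cont image_compactin by fastforce
  have Jsub: "J \<subseteq> f ` (X closure_of edge x)" unfolding J_def
    using closure_of_subset[OF Esub] by blast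
  then have "bounded J" using comp compact_imp_bounded bounded_subset by blast
  have "J \<noteq> {}" using T(2) by (auto simp: J_def)
  define c c' where "c = Inf J" and "c' = Sup J"
  have bdd: "bdd_below J" "bdd_above J" using \<open>bounded J\<close> by (simp_all add: bounded_imp_bdd_below bounded_imp_bdd_above)
  have notin: "c \<notin> J" "c' \<notin> J"
  proof -
    show "c \<notin> J"
    proof
      assume "c \<in> J"
      then obtain e where "e > 0" "ball c e \<subseteq> J" using \<open>open J\<close> openE by blast
      then have "c - e/2 \<in> J" by (auto simp: dist_real_def)
      then show False using cInf_lower[OF _ bdd(1)] \<open>e > 0\<close> by (fastforce simp: c_def)
    qed
    show "c' \<notin> J"
    proof
      assume "c' \<in> J"
      then obtain e where "e > 0" "ball c' e \<subseteq> J" using \<open>open J\<close> openE by blast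
      then have "c' + e/2 \<in> J" by (auto simp: dist_real_def)
      then show False using cSup_upper[OF _ bdd(2)] \<open>e > 0\<close> by (fastforce simp: c'_def)
    qed
  qed
  have J: "J = {c<..<c'}"
  proof
    show "J \<subseteq> {c<..<c'}"
    proof
      fix t assume "t \<in> J"
      then have "c \<le> t" "t \<le> c'" using bdd cInf_lower cSup_upper by (auto simp: c_def c'_def)
      moreover have "t \<noteq> c" "t \<noteq> c'" using \<open>t \<in> J\<close> notin by auto
      ultimately show "t \<in> {c<..<c'}" by auto
    qed
    show "{c<..<c'} \<subseteq> J"
    proof
      fix t assume t: "t \<in> {c<..<c'}"
      obtain a where "a \<in> J" "a < t" using t cInf_lessD[OF \<open>J \<noteq> {}\<close>] by (auto simp: c_def)
      moreover obtain b where "b \<in> J" "t < b" using t less_cSupE[OF _ \<open>J \<noteq> {}\<close>] by (auto simp: c'_def)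
      ultimately show "t \<in> J" using \<open>connected J\<close> unfolding connected_iff_interval by (meson less_imp_le)
    qed
  qed
  have "c < c'" using J \<open>J \<noteq> {}\<close> by auto
  show thesis
  proof (rule that[OF \<open>c < c'\<close>])
    show "f ` edge x = {c<..<c'}" using J J_def by simp
    fix b assume b: "b \<in> {c, c'}"
    then have "b \<in> closure J" using J \<open>c < c'\<close> by (auto simp: closure_greaterThanLessThan)
    then have "b \<in> f ` (X closure_of edge x)"
      using closure_minimal[OF Jsub] comp compact_imp_closed by blast
    then obtain z where z: "z \<in> X closure_of edge x" "f z = b" by auto
    then have "f z \<notin> J" using b notin by auto
    then have "z \<notin> edge x" by (auto simp: J_def)
    then show "\<exists>z \<in> X closure_of edge x. f z = b \<and> lc z \<inter> Cr A f \<noteq> {}"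
      using edge_frontier(2)[OF x z(1)] z by blast
  qed
qed

lemma essential_components_iff:
  "K \<in> essential_components X A f c \<longleftrightarrow> (\<exists>x\<in>Cr A f. f x = c \<and> K = lc x)"
proof
  assume "K \<in> essential_components X A f c"
  then obtain x where K: "K \<in> connected_components_of (subtopology X (level X f c))" and x: "x \<in> K" "x \<in> Cr A f"
    unfolding essential_components_def by blast
  have "x \<in> level X f c" using connected_components_of_subset[OF K] x by auto
  then have fx: "f x = c" by (auto simp: level_def)
  obtain y where "K = connected_component_of_set (subtopology X (level X f c)) y"
    using K by (auto simp: connected_components_of_def)
  then have "K = lc x"
    unfolding level_component_def fx using x by (metis connected_component_of_equiv mem_Collect_eq)
  then show "\<exists>x\<in>Cr A f. f x = c \<and> K = lc x" using x fx by blast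
next
  assume "\<exists>x\<in>Cr A f. f x = c \<and> K = lc x"
  then obtain x where x: "x \<in> Cr A f" "f x = c" "K = lc x" by blast
  then have xt: "x \<in> topspace X" using crit_subset by blast
  have "x \<in> K" using x xt in_level_component by metis
  moreover have "K \<in> connected_components_of (subtopology X (level X f c))"
    unfolding x(3) level_component_def x(2) using xt x(2)
    by (auto simp: connected_component_in_connected_components_of level_def)
  ultimately show "K \<in> essential_components X A f c" using x by (auto simp: essential_components_def)
qed

lemma essential_lc:
  assumes "z \<in> topspace X" "lc z \<inter> Cr A f \<noteq> {}"
  shows "lc z \<in> essential_components X A f (f z)"
proof -
  obtain y where y: "y \<in> lc z" "y \<in> Cr A f" using assms by blast
  then show ?thesis
    unfolding essential_components_iff
    by (intro bexI[of _ y]) (simp_all add: lc_sub level_component_eq)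
qed

lemma edge_component_slab:
  assumes x: "x \<in> topspace X" "lc x \<inter> Cr A f = {}" and J: "f ` edge x = {c<..<c'}"
  shows "edge x \<in> connected_components_of (subtopology X (slab X f c c'))"
proof -
  note T = tube_edge[OF x]
  have Esub: "edge x \<subseteq> slab X f c c'" using T(1) J openin_subset by (fastforce simp: tube_def slab_def)
  have "edge x = connected_component_of_set (subtopology X (slab X f c c')) x"
  proof
    show "edge x \<subseteq> connected_component_of_set (subtopology X (slab X f c c')) x"
      using T Esub by (intro connected_component_of_maximal) (auto simp: connectedin_subtopology tube_def)
    have con: "connectedin (subtopology X (slab X f c c')) (connected_component_of_set (subtopology X (slab X f c c')) x)"
      by (rule connectedin_connected_component_of)
    then have *: "connectedin X (connected_component_of_set (subtopology X (slab X f c c')) x)"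
      "connected_component_of_set (subtopology X (slab X f c c')) x \<subseteq> slab X f c c'"
      by (auto simp: connectedin_subtopology)
    show "connected_component_of_set (subtopology X (slab X f c c')) x \<subseteq> edge x"
    proof (rule connectedin_subset_clopen[OF *(1)])
      show "openin X (edge x)" "openin X ({y \<in> topspace X. f y \<in> f ` edge x} - edge x)"
        using T by (auto simp: tube_def)
      show "connected_component_of_set (subtopology X (slab X f c c')) x \<subseteq> edge x \<union> ({y \<in> topspace X. f y \<in> f ` edge x} - edge x)"
        using *(2) by (auto simp: J slab_def)
      have "x \<in> connected_component_of_set (subtopology X (slab X f c c')) x"
        using T Esub x by (auto simp: connected_component_of_refl)
      then show "connected_component_of_set (subtopology X (slab X f c c')) x \<inter> edge x \<noteq> {}" using T by blast
    qed auto
  qed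
  then show ?thesis
    using T(2) Esub x by (metis IntI connected_component_in_connected_components_of subsetD topspace_subtopology)
qed

lemma type_IIa_edge:
  assumes x: "x \<in> topspace X" "lc x \<inter> Cr A f = {}"
  shows "\<exists>c c'. type_IIa X A f c c' (edge x)"
proof -
  note T = tube_edge[OF x]
  obtain c c' where cc: "c < c'" and J: "f ` edge x = {c<..<c'}" and
    lim: "\<And>b. b \<in> {c, c'} \<Longrightarrow> \<exists>z \<in> X closure_of edge x. f z = b \<and> lc z \<inter> Cr A f \<noteq> {}"
    using edge_interval[OF x] by blast
  have ess: "b \<in> f ` Cr A f \<and> (\<exists>K\<in>essential_components X A f b. (X closure_of edge x) \<inter> K \<noteq> {})"
    if bc: "b \<in> {c, c'}" for b
  proof -
    obtain z where z: "z \<in> X closure_of edge x" "f z = b" "lc z \<inter> Cr A f \<noteq> {}" using lim[OF bc] by (elim bexE conjE)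
    then have zt: "z \<in> topspace X" using closure_of_subset_topspace by fastforce
    then have "lc z \<in> essential_components X A f b" using essential_lc z by blast
    moreover have "z \<in> lc z" using zt in_level_component by metis
    moreover have "b \<in> f ` Cr A f"
    proof -
      obtain y where "y \<in> lc z" "y \<in> Cr A f" using z(3) by blast
      then show ?thesis using z(2) by (intro image_eqI[of _ _ y]) (simp_all add: lc_sub)
    qed
    ultimately show ?thesis using z(1) by blast
  qed
  have "type_IIa X A f c c' (edge x)"
    unfolding type_IIa_def
    using cc ess[of c] ess[of c'] edge_component_slab[OF x J] T by (auto simp: tube_def)
  then show ?thesis by blast
qed

text \<open>
  The part of \<open>edge x\<close> over \<open>(c, c')\<close> is connected and hence lies in \<open>C\<close>. If the values of \<open>edge x\<close> ended
  strictly inside \<open>(c, c')\<close>, the closed subset \<open>C\<close> of the slab would contain the essential component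
  where the edge ends. So \<open>edge x\<close> reaches over all of \<open>(c, c')\<close> and, being a component of its own
  slab, contains \<open>C\<close>. The same argument with the essential components touched by the closure of
  \<open>C\<close> shows that \<open>edge x\<close> does not reach beyond \<open>c\<close> and \<open>c'\<close>.
\<close>

lemma type_IIa_is_edge:
  assumes C: "type_IIa X A f c c' C" and xC: "x \<in> C"
  shows "x \<in> topspace X" "lc x \<inter> Cr A f = {}" "C = edge x" "f ` C = {c<..<c'}"
proof -
  let ?S = "subtopology X (slab X f c c')"
  have comp: "C \<in> connected_components_of ?S" and nocr: "C \<inter> Cr A f = {}" using C by (auto simp: type_IIa_def)
  have Csub: "C \<subseteq> slab X f c c'" using connected_components_of_subset[OF comp] by auto
  have connC: "connectedin X C"
    using connectedin_connected_components_of[OF comp] by (simp add: connectedin_subtopology)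
  have max: "D \<subseteq> C" if "connectedin X D" "D \<subseteq> slab X f c c'" "D \<inter> C \<noteq> {}" for D
    using connected_components_of_maximal[OF comp, of D] that by (auto simp: connectedin_subtopology disjnt_def)
  have lcC: "lc y \<subseteq> C" if "y \<in> C" for y
  proof (rule max[OF connectedin_level_component])
    have "y \<in> slab X f c c'" using that Csub by blast
    then show "lc y \<subseteq> slab X f c c'" using lc_sub by (fastforce simp: slab_def)
    show "lc y \<inter> C \<noteq> {}" using that Csub in_level_component by (fastforce simp: slab_def)
  qed
  show x: "x \<in> topspace X" using xC Csub by (auto simp: slab_def)
  show xn: "lc x \<inter> Cr A f = {}" using lcC[OF xC] nocr by blast
  note T = tube_edge[OF x xn]
  have closedC: "z \<in> C" if "z \<in> X closure_of C" "z \<in> slab X f c c'" for z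
  proof -
    have "closedin ?S C" using comp closedin_connected_components_of by blast
    then obtain D where "closedin X D" "C = D \<inter> slab X f c c'" by (auto simp: closedin_subtopology)
    then show ?thesis using that closure_of_minimal[of C D X] by blast
  qed
  obtain a a' where aa: "a < a'" and J: "f ` edge x = {a<..<a'}" and
    lim: "\<And>b. b \<in> {a, a'} \<Longrightarrow> \<exists>z \<in> X closure_of edge x. f z = b \<and> lc z \<inter> Cr A f \<noteq> {}"
    using edge_interval[OF x xn] by blast
  have Etop: "edge x \<subseteq> topspace X" using T openin_subset by (auto simp: tube_def)
  have fx: "a < f x" "f x < a'" "c < f x" "f x < c'"
    using T(2) J xC Csub by (auto simp: slab_def)
  define P where "P = {z \<in> edge x. c < f z \<and> f z < c'}"
  have PC: "P \<subseteq> C"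
  proof (rule max)
    have fP: "f ` P = {max a c<..<min a' c'}"
    proof -
      have "f ` P = f ` edge x \<inter> {c<..<c'}" by (auto simp: P_def)
      then show ?thesis by (auto simp: J)
    qed
    show "connectedin X P"
    proof (rule connectedin_fibres)
      have "P = edge x \<inter> {z \<in> topspace X. f z \<in> {c<..<c'}}" using Etop by (auto simp: P_def)
      then show "openin X P" using T open_vimage[of "{c<..<c'}"] by (auto simp: tube_def)
      show "P \<inter> Cr A f = {}" using T by (auto simp: P_def tube_def)
      show "connected (f ` P)" unfolding fP by simp
      show "v \<in> lc u" if "u \<in> P" "v \<in> P" "f v = f u" for u v
        using that T by (auto simp: P_def tube_def)
      show "lc u \<subseteq> P" if "u \<in> P" for u
        using that tube_lc[OF T(1), of u] lc_sub by (force simp: P_def)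
    qed
    show "P \<subseteq> slab X f c c'" using Etop by (auto simp: P_def slab_def)
    show "P \<inter> C \<noteq> {}" using T(2) fx xC by (auto simp: P_def)
  qed
  have ends: "\<not> (c < b \<and> b < c')" if b: "b \<in> {a, a'}" for b
  proof
    assume cb: "c < b \<and> b < c'"
    obtain z where z: "z \<in> X closure_of edge x" "f z = b" "lc z \<inter> Cr A f \<noteq> {}" using lim[OF b] by (elim bexE conjE)
    have zt: "z \<in> topspace X" using z closure_of_subset_topspace by fastforce
    have "z \<in> X closure_of P"
    proof -
      have P_Int: "P = {y \<in> topspace X. f y \<in> {c<..<c'}} \<inter> edge x" using Etop by (auto simp: P_def)
      have "z \<in> {y \<in> topspace X. f y \<in> {c<..<c'}} \<inter> X closure_of edge x" using z zt cb by simp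
      then show ?thesis
        unfolding P_Int using openin_Int_closure_of_subset[OF open_vimage[OF open_greaterThanLessThan], of c c' "edge x"] by blast
    qed
    then have "z \<in> X closure_of C" using closure_of_mono[OF PC] by blast
    then have "z \<in> C" using closedC zt cb z by (auto simp: slab_def)
    then show False using lcC nocr z by blast
  qed
  have le: "a \<le> c" "c' \<le> a'" using ends[of a] ends[of a'] fx by auto
  have CE: "C \<subseteq> edge x"
  proof (rule connected_components_of_maximal[OF edge_component_slab[OF x xn J]])
    show "connectedin (subtopology X (slab X f a a')) C"
      using connC Csub le by (force simp: connectedin_subtopology slab_def)
    show "\<not> disjnt (edge x) C" using xC T(2) by (auto simp: disjnt_def)
  qed
  have ends': "\<not> (a < b \<and> b < a')" if b: "b \<in> {c, c'}" for b
  proof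
    assume ab: "a < b \<and> b < a'"
    obtain K where K: "K \<in> essential_components X A f b" "(X closure_of C) \<inter> K \<noteq> {}"
      using C b unfolding type_IIa_def by blast
    then obtain z where z: "z \<in> X closure_of C" "z \<in> K" by blast
    obtain y where y: "y \<in> Cr A f" "f y = b" "K = lc y" using K essential_components_iff by blast
    have fz: "f z = b" using lc_sub[of z y] z y by simp
    have "z \<in> X closure_of edge x" using z(1) closure_of_mono[OF CE] by blast
    then have "z \<in> edge x" using edge_frontier(1)[OF x xn, of z] fz ab J by auto
    then have "lc z \<inter> Cr A f = {}" using tube_lc[OF T(1)] T(1) by (auto simp: tube_def)
    moreover have "lc z = lc y" using z y level_component_eq by metis
    moreover have "y \<in> lc y" using y crit_subset in_level_component by (metis subsetD)
    ultimately show False using y by blast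
  qed
  have eq: "a = c" "c' = a'" using ends'[of c] ends'[of c'] le fx by auto
  have "edge x \<subseteq> P" using J eq by (auto simp: P_def)
  then have "edge x \<subseteq> C" using PC by blast
  then show "C = edge x" using CE by blast
  then show "f ` C = {c<..<c'}" using J eq by simp
qed

section \<open>The Reeb graph is Hausdorff\<close>

text \<open>
  For two components of the same level, a clopen subset of the level that contains just one of
  them exists by equality of components and quasi-components. Disjoint neighbourhoods of this subset and of
  its complement in the level, cut down to nearby levels, are saturated: nearby levels
  lie in their union, so that a connected subset of such a level lies in one of them.
\<close>

lemma separate_level_components:
  assumes x: "x \<in> topspace X" and y: "y \<in> topspace X" and ne: "lc x \<noteq> lc y"
  shows "\<exists>U V. openin X U \<and> openin X V \<and> x \<in> U \<and> y \<in> V \<and> U \<inter> V = {} \<and>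
    (\<forall>z\<in>U. lc z \<subseteq> U) \<and> (\<forall>z\<in>V. lc z \<subseteq> V)"
proof (cases "f x = f y")
  case False
  then obtain S T where ST: "open S" "open T" "f x \<in> S" "f y \<in> T" "S \<inter> T = {}"
    using separation_t2[of "f x" "f y"] by blast
  show ?thesis
  proof (intro exI conjI ballI)
    show "openin X {z \<in> topspace X. f z \<in> S}" "openin X {z \<in> topspace X. f z \<in> T}"
      by (intro open_vimage ST)+
  qed (use ST x y lc_sub in auto)
next
  case True
  define t where "t = f x"
  let ?S = "subtopology X (level X f t)"
  have xy: "x \<in> topspace ?S" "y \<in> topspace ?S" using x y True by (auto simp: t_def level_def)
  have "compactin X (level X f t)" using closed_level compact closedin_compact_space by blast
  then have "compact_space ?S" by (simp add: compact_space_subtopology)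
  moreover have "Hausdorff_space ?S" using hausdorff by (simp add: Hausdorff_space_subtopology)
  ultimately have "quasi_component_of ?S x = connected_component_of ?S x"
    by (intro quasi_eq_connected_component_of) blast
  moreover have "\<not> connected_component_of ?S x y"
  proof
    assume "connected_component_of ?S x y"
    then have "y \<in> lc x" by (simp add: level_component_def t_def)
    then show False using level_component_eq ne by metis
  qed
  ultimately have "\<not> quasi_component_of ?S x y" by simp
  then obtain P where P: "closedin ?S P" "openin ?S P" "\<not> (x \<in> P \<longleftrightarrow> y \<in> P)"
    using xy unfolding quasi_component_of_def by blast
  have "\<exists>P. closedin ?S P \<and> openin ?S P \<and> x \<in> P \<and> y \<notin> P"
  proof (cases "x \<in> P")
    case True
    then show ?thesis using P by blast
  next
    case False
    have "closedin ?S (topspace ?S - P)" "openin ?S (topspace ?S - P)"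
      by (fact closedin_diff[OF closedin_topspace P(2)] openin_diff[OF openin_topspace P(1)])+
    then show ?thesis using False P(3) xy by blast
  qed
  then obtain Q where Q: "closedin ?S Q" "openin ?S Q" "x \<in> Q" "y \<notin> Q" by blast
  have "closedin ?S (topspace ?S - Q)" by (rule closedin_diff[OF closedin_topspace Q(2)])
  then have clo: "closedin X Q" "closedin X (topspace ?S - Q)"
    using Q(1) closedin_trans_full closed_level by blast+
  have "normal_space X" using compact hausdorff compact_Hausdorff_or_regular_imp_normal_space by blast
  then obtain U V where UV: "openin X U" "openin X V" "Q \<subseteq> U" "topspace ?S - Q \<subseteq> V" "disjnt U V"
    unfolding normal_space_def using clo by (metis Diff_disjoint disjnt_def)
  have "level X f t \<subseteq> U \<union> V" using UV closed_level[THEN closedin_subset] by auto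
  then have "\<forall>\<^sub>F s in nhds t. level X f s \<subseteq> U \<union> V"
    using UV by (intro eventually_level_subset) auto
  then obtain S where S: "open S" "t \<in> S" "\<And>s. s \<in> S \<Longrightarrow> level X f s \<subseteq> U \<union> V"
    unfolding eventually_nhds by blast
  have sat: "lc z \<subseteq> N \<inter> {z \<in> topspace X. f z \<in> S}"
    if z: "z \<in> N \<inter> {z \<in> topspace X. f z \<in> S}" and N: "(N, N') = (U, V) \<or> (N, N') = (V, U)" for z N N'
  proof -
    have "lc z \<subseteq> N"
    proof (rule connectedin_subset_clopen[OF connectedin_level_component])
      show "openin X N" "openin X N'" using N UV by auto
      have "lc z \<subseteq> U \<union> V" using level_component_subset[of X f z] S(3)[of "f z"] z by blast
      then show "lc z \<subseteq> N \<union> N'" using N by blast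
      show "N \<inter> N' \<inter> lc z = {}" using N UV(5) by (auto simp: disjnt_def)
      show "lc z \<inter> N \<noteq> {}" using z in_level_component[of z X f] by blast
    qed
    then show ?thesis using z lc_sub by fastforce
  qed
  show ?thesis
  proof (intro exI conjI ballI)
    show "openin X (U \<inter> {z \<in> topspace X. f z \<in> S})" "openin X (V \<inter> {z \<in> topspace X. f z \<in> S})"
      using UV(1,2) open_vimage[OF S(1)] by auto
    show "x \<in> U \<inter> {z \<in> topspace X. f z \<in> S}" using Q(3) UV(3) x S(2) by (auto simp: t_def)
    show "y \<in> V \<inter> {z \<in> topspace X. f z \<in> S}" using Q(4) UV(4) xy(2) y S(2) True by (auto simp: t_def)
    show "(U \<inter> {z \<in> topspace X. f z \<in> S}) \<inter> (V \<inter> {z \<in> topspace X. f z \<in> S}) = {}"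
      using UV(5) by (auto simp: disjnt_def)
  qed (use sat in blast)+
qed

lemma Hausdorff_reeb_graph: "Hausdorff_space (reeb_graph X f)"
  unfolding Hausdorff_space_def topspace_reeb_graph
proof (intro allI impI)
  fix a b assume ab: "a \<in> lc ` topspace X \<and> b \<in> lc ` topspace X \<and> a \<noteq> b"
  then obtain x y where xy: "x \<in> topspace X" "a = lc x" "y \<in> topspace X" "b = lc y" by blast
  then obtain U V where UV: "openin X U" "openin X V" "x \<in> U" "y \<in> V" "U \<inter> V = {}"
    and sat: "\<forall>z\<in>U. lc z \<subseteq> U" "\<forall>z\<in>V. lc z \<subseteq> V"
    using separate_level_components[of x y] ab by blast
  have self: "z \<in> lc z" if "z \<in> topspace X" for z using that in_level_component by fast
  have op: "openin (reeb_graph X f) (lc ` W)" if W: "openin X W" "\<forall>z\<in>W. lc z \<subseteq> W" for W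
  proof -
    have "{z \<in> topspace X. lc z \<in> lc ` W} = W"
      using W(2) openin_subset[OF W(1)] self by blast
    then show ?thesis using W(1) openin_subset[OF W(1)] by (auto simp: openin_reeb_graph)
  qed
  have "disjnt (lc ` U) (lc ` V)"
  proof -
    have False if "u \<in> U" "v \<in> V" "lc u = lc v" for u v
      using that sat UV(5) self[of u] openin_subset[OF UV(1)] by blast
    then show ?thesis unfolding disjnt_def by blast
  qed
  then show "\<exists>U V. openin (reeb_graph X f) U \<and> openin (reeb_graph X f) V \<and> a \<in> U \<and> b \<in> V \<and> disjnt U V"
    using op[OF UV(1) sat(1)] op[OF UV(2) sat(2)] xy UV(3,4) by blast
qed

end

section \<open>Contractibility of finite trees\<close>

text \<open>
  The first vertex of a longest path is a leaf: its neighbours all lie on the path,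
  and one beyond the second vertex would close a cycle.
\<close>

lemma finite_tree_leaf:
  assumes tree: "finite_tree V E" and two: "\<And>r. V \<noteq> {r}"
  obtains v w where "v \<in> V" "w \<in> V" "v \<noteq> w" "{v, w} \<in> E" "\<And>e. e \<in> E \<Longrightarrow> v \<in> e \<Longrightarrow> e = {v, w}"
proof -
  have fin: "finite V" and ne: "V \<noteq> {}"
    and edge: "\<And>e. e \<in> E \<Longrightarrow> \<exists>u\<in>V. \<exists>v\<in>V. u \<noteq> v \<and> e = {u, v}"
    and conn: "\<And>u v. u \<in> V \<Longrightarrow> v \<in> V \<Longrightarrow> (u, v) \<in> {(a, b). {a, b} \<in> E}\<^sup>*"
    and acyc: "\<And>p. \<lbrakk>length p \<ge> 3; distinct p; \<forall>i. Suc i < length p \<longrightarrow> {p ! i, p ! Suc i} \<in> E;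
       {last p, hd p} \<in> E\<rbrakk> \<Longrightarrow> False"
    using tree unfolding finite_tree_def by blast+
  define path where "path = (\<lambda>p. distinct p \<and> set p \<subseteq> V \<and> (\<forall>i. Suc i < length p \<longrightarrow> {p ! i, p ! Suc i} \<in> E))"
  obtain r where r: "r \<in> V" using ne by blast
  obtain s where s: "s \<in> V" "s \<noteq> r" using two[of r] r by blast
  obtain q where q: "{r, q} \<in> E"
    using conn[OF r s(1)] s(2) by (auto elim: converse_rtranclE)
  then obtain x y where xy: "x \<in> V" "y \<in> V" "x \<noteq> y" "{x, y} \<in> E" using edge by metis
  then have p0: "path [x, y]" by (auto simp: path_def less_Suc_eq nth_Cons')
  have "\<forall>p. path p \<longrightarrow> length p < Suc (card V)"
    unfolding path_def using fin by (metis card_mono distinct_card less_Suc_eq_le)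
  then obtain p where p: "path p" and max: "\<And>p'. path p' \<Longrightarrow> length p' \<le> length p"
    using ex_has_greatest_nat[of path "[x, y]" length, OF p0] by blast
  have len: "2 \<le> length p" using max[OF p0] by simp
  have dp: "distinct p" and sp: "set p \<subseteq> V" and pp: "\<And>i. Suc i < length p \<Longrightarrow> {p ! i, p ! Suc i} \<in> E"
    using p by (auto simp: path_def)
  define v w where "v = p ! 0" and "w = p ! 1"
  have v: "v \<in> V" "w \<in> V" using len sp by (auto simp: v_def w_def intro!: subsetD[OF sp] nth_mem)
  have vw: "v \<noteq> w" using nth_eq_iff_index_eq[OF dp, of 0 1] len unfolding v_def w_def by linarith
  have vwE: "{v, w} \<in> E" using pp[of 0] len by (simp add: v_def w_def)
  have uniq: "e = {v, w}" if e: "e \<in> E" "v \<in> e" for e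
  proof -
    obtain x where x: "x \<in> V" "x \<noteq> v" "e = {v, x}" using edge[OF e(1)] e(2) by blast
    have "x \<in> set p"
    proof (rule ccontr)
      assume "x \<notin> set p"
      then have "path (x # p)"
        using dp sp pp x e v len
        by (auto simp: path_def nth_Cons v_def insert_commute split: nat.splits)
      then show False using max by fastforce
    qed
    then obtain i where i: "i < length p" "x = p ! i" by (metis in_set_conv_nth)
    have "i \<noteq> 0" using x(2) i(2) unfolding v_def by metis
    have "i = 1"
    proof (rule ccontr)
      assume "i \<noteq> 1"
      let ?q = "take (Suc i) p"
      have lq: "length ?q = Suc i" using i by simp
      have "last ?q = x" using i by (simp add: take_Suc_conv_app_nth)
      moreover have "hd ?q = v" using len by (cases p) (auto simp: v_def)
      ultimately have "{last ?q, hd ?q} \<in> E" using x e by (simp add: insert_commute)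
      moreover have "\<forall>k. Suc k < length ?q \<longrightarrow> {?q ! k, ?q ! Suc k} \<in> E" using pp i by simp
      moreover have "3 \<le> length ?q" using lq \<open>i \<noteq> 0\<close> \<open>i \<noteq> 1\<close> by linarith
      moreover have "distinct ?q" using dp by simp
      ultimately show False using acyc[of ?q] by blast
    qed
    then show ?thesis using x i by (simp add: w_def)
  qed
  show thesis by (rule that[OF v vw vwE uniq])
qed

text \<open>
  Connectedness survives because moving \<open>v\<close> onto its neighbour \<open>w\<close> turns walks into walks that avoid \<open>v\<close>.
\<close>

lemma finite_tree_delete_leaf:
  assumes tree: "finite_tree V E" and v: "v \<in> V" "w \<in> V" "v \<noteq> w" "{v, w} \<in> E"
    and leaf: "\<And>e. e \<in> E \<Longrightarrow> v \<in> e \<Longrightarrow> e = {v, w}"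
  shows "finite_tree (V - {v}) (E - {{v, w}})"
proof -
  let ?V = "V - {v}" and ?E = "E - {{v, w}}"
  let ?R = "{(a, b). {a, b} \<in> E}" and ?R' = "{(a, b). {a, b} \<in> ?E}"
  let ?f = "\<lambda>x. if x = v then w else x"
  have edge: "\<And>e. e \<in> E \<Longrightarrow> \<exists>u\<in>V. \<exists>v\<in>V. u \<noteq> v \<and> e = {u, v}"
    and conn: "\<And>u v. u \<in> V \<Longrightarrow> v \<in> V \<Longrightarrow> (u, v) \<in> ?R\<^sup>*"
    and acyc: "\<not> (\<exists>p. length p \<ge> 3 \<and> distinct p \<and>
            (\<forall>i. Suc i < length p \<longrightarrow> {p ! i, p ! Suc i} \<in> E) \<and> {last p, hd p} \<in> E)"
    using tree unfolding finite_tree_def by blast+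
  have edge_step: "(?f a, ?f b) \<in> ?R'\<^sup>*" if "(a, b) \<in> ?R" for a b
  proof (cases "v \<in> {a, b}")
    case True
    then have "{a, b} = {v, w}" using leaf that by blast
    then have "?f a = ?f b" by (auto simp: doubleton_eq_iff)
    then show ?thesis by (simp only: rtrancl.rtrancl_refl)
  next
    case False
    then have "{a, b} \<noteq> {v, w}" by blast
    then show ?thesis using that False by auto
  qed
  have conn': "(?f a, ?f b) \<in> ?R'\<^sup>*" if "(a, b) \<in> ?R\<^sup>*" for a b
    using that
  proof induction
    case (step b c)
    show ?case by (rule rtrancl_trans[OF step.IH edge_step[OF step.hyps(2)]])
  qed (rule rtrancl_refl)
  show ?thesis
    unfolding finite_tree_def
  proof (intro conjI ballI)
    show "finite ?V" using tree by (simp add: finite_tree_def)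
    show "?V \<noteq> {}" using v by blast
    show "\<exists>u\<in>?V. \<exists>y\<in>?V. u \<noteq> y \<and> e = {u, y}" if "e \<in> ?E" for e
      using edge[of e] leaf[of e] that by blast
    show "(a, b) \<in> ?R'\<^sup>*" if "a \<in> ?V" "b \<in> ?V" for a b
      using conn'[OF conn[of a b]] that by auto
    show "\<not> (\<exists>p. length p \<ge> 3 \<and> distinct p \<and>
            (\<forall>i. Suc i < length p \<longrightarrow> {p ! i, p ! Suc i} \<in> ?E) \<and> {last p, hd p} \<in> ?E)"
      using acyc by blast
  qed
qed

text \<open>
  The realization of \<open>(V, E)\<close> inside the functions on a larger set \<open>N\<close> of vertices. Keeping \<open>N\<close> fixed
  makes the realization of a subgraph an honest subset of that of the graph, so that leaves can be
  removed by a deformation retraction.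
\<close>

definition partial_realization :: "'a set \<Rightarrow> 'a set \<Rightarrow> 'a set set \<Rightarrow> ('a \<Rightarrow> real) set" where
  "partial_realization N V E =
     {x. (\<forall>w\<in>N. 0 \<le> x w) \<and> (\<Sum>w\<in>N. x w) = 1 \<and>
         ((\<exists>v\<in>V. {w\<in>N. x w \<noteq> 0} = {v}) \<or> {w\<in>N. x w \<noteq> 0} \<in> E)}"

text \<open>
  Shifting the barycentric weight of a leaf \<open>v\<close> to its neighbour \<open>w\<close> is a deformation retraction onto the
  realization without \<open>v\<close>: the points with positive weight at \<open>v\<close> are supported in the edge \<open>{v, w}\<close> and
  remain there.
\<close>

lemma contractible_partial_realization:
  assumes "finite_tree V E" "V \<subseteq> N" "finite N"
  shows "contractible_space (subtopology (powertop_real N) (partial_realization N V E))"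
  using assms(1,2)
proof (induction "card V" arbitrary: V E rule: less_induct)
  case less
  note tree = \<open>finite_tree V E\<close>
  show ?case
  proof (cases "\<exists>r. V = {r}")
    case True
    then obtain r where r: "V = {r}" by blast
    have "E = {}" using tree r by (force simp: finite_tree_def)
    have "topspace (subtopology (powertop_real N) (partial_realization N V E)) \<subseteq> {realization_vertex N r}"
    proof
      fix x assume "x \<in> topspace (subtopology (powertop_real N) (partial_realization N V E))"
      then have x: "x \<in> extensional N" "(\<Sum>w\<in>N. x w) = 1" "{w\<in>N. x w \<noteq> 0} = {r}"
        using r \<open>E = {}\<close> by (auto simp: partial_realization_def PiE_def)
      have "(\<Sum>w\<in>N. x w) = (\<Sum>w\<in>{r}. x w)"
        using x(3) assms(3) by (intro sum.mono_neutral_right) auto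
      then have "x r = 1" using x(2) by simp
      then have "x w = realization_vertex N r w" for w
        using x(1,3) by (cases "w \<in> N") (auto simp: realization_vertex_def extensional_def)
      then show "x \<in> {realization_vertex N r}" by auto
    qed
    then show ?thesis by (rule contractible_space_subset_singleton)
  next
    case False
    then obtain v w where v: "v \<in> V" "w \<in> V" "v \<noteq> w" "{v, w} \<in> E"
      and leaf: "\<And>e. e \<in> E \<Longrightarrow> v \<in> e \<Longrightarrow> e = {v, w}"
      using finite_tree_leaf[OF tree] by metis
    define V' E' where "V' = V - {v}" and "E' = E - {{v, w}}"
    have tree': "finite_tree V' E'"
      unfolding V'_def E'_def by (rule finite_tree_delete_leaf[OF tree v leaf])
    have "card V' < card V" using v(1) less.prems(2) assms(3)
      unfolding V'_def by (meson card_Diff1_less finite_subset)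
    then have IH: "contractible_space (subtopology (powertop_real N) (partial_realization N V' E'))"
      using less.hyps tree' less.prems(2) by (auto simp: V'_def)
    let ?P = "powertop_real N"
    let ?S = "partial_realization N V E" and ?S' = "partial_realization N V' E'"
    let ?X = "subtopology ?P ?S" and ?Y = "subtopology ?P ?S'"
    have vN: "v \<in> N" "w \<in> N" using v less.prems(2) by auto
    define H where "H = (\<lambda>(t::real, x). \<lambda>u\<in>N. if u = v then (1 - t) * x v else if u = w then x w + t * x v else x u)"
    have sub: "?S' \<subseteq> ?S" by (auto simp: partial_realization_def V'_def E'_def)
    have topX: "x \<in> topspace ?X \<longleftrightarrow> x \<in> extensional N \<and> x \<in> ?S" for x by (auto simp: PiE_def)
    have topY: "x \<in> topspace ?Y \<longleftrightarrow> x \<in> extensional N \<and> x \<in> ?S'" for x by (auto simp: PiE_def)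
    have H_id: "H (t, x) = x" if "x \<in> extensional N" "x v = 0" for t x
      using that vN by (auto simp: H_def fun_eq_iff extensional_def)
    have supp_v: "{u \<in> N. x u \<noteq> 0} = {v} \<or> {u \<in> N. x u \<noteq> 0} = {v, w}" if "x \<in> ?S" "x v \<noteq> 0" for x
    proof -
      define s where "s = {u \<in> N. x u \<noteq> 0}"
      have "v \<in> s" using vN that by (simp add: s_def)
      moreover have "(\<exists>y\<in>V. s = {y}) \<or> s \<in> E" using that(1) by (simp add: partial_realization_def s_def)
      ultimately have "s = {v} \<or> s = {v, w}" using leaf by blast
      then show ?thesis by (simp add: s_def)
    qed
    have pos: "\<forall>u\<in>N. 0 \<le> H (t, x) u" and sum1: "(\<Sum>u\<in>N. H (t, x) u) = 1" if "x \<in> ?S" "t \<in> {0..1}" for x t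
    proof -
      show "\<forall>u\<in>N. 0 \<le> H (t, x) u"
        using that vN by (auto simp: H_def partial_realization_def)
      have "(\<Sum>u\<in>N. H (t, x) u) = (\<Sum>u\<in>N. x u + (if u = w then t * x v else 0) - (if u = v then t * x v else 0))"
        using v(3) by (intro sum.cong) (auto simp: H_def algebra_simps)
      also have "\<dots> = (\<Sum>u\<in>N. x u)"
        using vN assms(3) by (simp add: sum.distrib sum_subtractf)
      finally show "(\<Sum>u\<in>N. H (t, x) u) = 1" using that by (simp add: partial_realization_def)
    qed
    have inS: "H (t, x) \<in> ?S" if "x \<in> ?S" "x \<in> extensional N" "t \<in> {0..1}" for t x
    proof (cases "x v = 0")
      case True
      then show ?thesis using H_id that by simp
    next
      case False
      have "{u \<in> N. H (t, x) u \<noteq> 0} \<subseteq> {v, w}"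
        using supp_v[OF that(1) False] by (auto simp: H_def split: if_splits)
      moreover have "{u \<in> N. H (t, x) u \<noteq> 0} \<noteq> {}"
      proof
        assume "{u \<in> N. H (t, x) u \<noteq> 0} = {}"
        then have "(\<Sum>u\<in>N. H (t, x) u) = 0" by (intro sum.neutral) blast
        then show False using sum1[OF that(1,3)] by simp
      qed
      ultimately have "{u \<in> N. H (t, x) u \<noteq> 0} = {v} \<or> {u \<in> N. H (t, x) u \<noteq> 0} = {w} \<or> {u \<in> N. H (t, x) u \<noteq> 0} = {v, w}"
        by blast
      then show ?thesis
        using pos[OF that(1,3)] sum1[OF that(1,3)] v by (auto simp: partial_realization_def)
    qed
    have inS': "H (1, x) \<in> ?S'" if "x \<in> ?S" "x \<in> extensional N" for x
    proof -
      define s where "s = {u \<in> N. H (1, x) u \<noteq> 0}"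
      have "H (1, x) \<in> ?S" using inS that by simp
      then have S: "\<forall>u\<in>N. 0 \<le> H (1, x) u" "(\<Sum>u\<in>N. H (1, x) u) = 1" "(\<exists>y\<in>V. s = {y}) \<or> s \<in> E"
        by (simp_all add: partial_realization_def s_def)
      moreover have "v \<notin> s" by (simp add: H_def s_def)
      then have "(\<exists>y\<in>V'. s = {y}) \<or> s \<in> E'" using S(3) unfolding V'_def E'_def by blast
      ultimately show ?thesis unfolding partial_realization_def s_def by blast
    qed
    have Y0: "x v = 0" if "x \<in> ?S'" for x
    proof (rule ccontr)
      assume "x v \<noteq> 0"
      define s where "s = {u \<in> N. x u \<noteq> 0}"
      have "v \<in> s" using vN \<open>x v \<noteq> 0\<close> by (simp add: s_def)
      moreover have "(\<exists>y\<in>V'. s = {y}) \<or> s \<in> E'" using that by (simp add: partial_realization_def s_def)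
      ultimately show False using leaf unfolding V'_def E'_def by blast
    qed
    have ext: "H z \<in> extensional N" for z by (simp add: H_def split: prod.splits)
    let ?Q = "prod_topology (top_of_set {0..1::real}) ?X"
    have contH: "continuous_map ?Q ?P H"
      unfolding continuous_map_componentwise
    proof (intro conjI ballI)
      show "H ` topspace ?Q \<subseteq> extensional N" using ext by blast
      fix k assume k: "k \<in> N"
      have fst: "continuous_map ?Q euclideanreal fst"
        using continuous_map_fst continuous_map_in_subtopology by blast
      have snd: "continuous_map ?Q euclideanreal (\<lambda>z. snd z u)" if "u \<in> N" for u
      proof -
        have "continuous_map ?X euclideanreal (\<lambda>x. x u)"
          by (intro continuous_map_from_subtopology continuous_map_product_projection that)
        from continuous_map_compose[OF continuous_map_snd this] show ?thesis by (simp add: o_def)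
      qed
      have "(\<lambda>z. H z k) = (\<lambda>z. if k = v then (1 - fst z) * snd z v else if k = w then snd z w + fst z * snd z v else snd z k)"
        using k by (auto simp: H_def split: prod.splits)
      moreover have "continuous_map ?Q euclideanreal (\<lambda>z. (1 - fst z) * snd z v)"
        "continuous_map ?Q euclideanreal (\<lambda>z. snd z w + fst z * snd z v)"
        by (intro continuous_intros fst snd vN continuous_map_real_mult continuous_map_diff continuous_map_add continuous_map_canonical_const)+
      ultimately show "continuous_map ?Q euclideanreal (\<lambda>z. H z k)"
        using snd[OF k] by simp
    qed
    have "homotopic_with (\<lambda>x. True) ?X ?X id (\<lambda>x. H (1, x))"
    proof (subst homotopic_with)
      show "\<exists>h. continuous_map ?Q ?X h \<and> (\<forall>x\<in>topspace ?X. h (0, x) = id x) \<and>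
        (\<forall>x\<in>topspace ?X. h (1, x) = H (1, x)) \<and> (\<forall>t\<in>{0..1::real}. True)"
      proof (intro exI[of _ H] conjI ballI)
        have "H z \<in> ?S" if "z \<in> topspace ?Q" for z
          using that inS topX by (cases z) auto
        then show "continuous_map ?Q ?X H"
          using contH by (auto simp: continuous_map_in_subtopology)
        show "H (0, x) = id x" if "x \<in> topspace ?X" for x
          using that by (auto simp: H_def fun_eq_iff topX extensional_def)
      qed auto
    qed auto
    then have "homotopic_with (\<lambda>x. True) ?X ?X (id \<circ> (\<lambda>x. H (1, x))) id"
      by (simp add: homotopic_with_sym)
    moreover have "retraction_maps ?X ?Y (\<lambda>x. H (1, x)) id"
      unfolding retraction_maps_def
    proof (intro conjI ballI)
      have "continuous_map ?X ?P (H \<circ> (\<lambda>x. (1, x)))"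
        by (rule continuous_map_compose[OF _ contH]) (auto intro!: continuous_intros)
      moreover have "H (1, x) \<in> ?S'" if "x \<in> topspace ?X" for x
        using that inS' topX by blast
      ultimately show "continuous_map ?X ?Y (\<lambda>x. H (1, x))"
        by (auto simp: continuous_map_in_subtopology o_def)
      show "continuous_map ?Y ?X id"
        using sub by (auto simp: continuous_map_in_subtopology)
      show "H (1, id x) = x" if "x \<in> topspace ?Y" for x
        using that H_id Y0 topY by auto
    qed
    ultimately have "?X homotopy_equivalent_space ?Y"
      by (rule deformation_retraction_imp_homotopy_equivalent_space)
    then show ?thesis using IH homotopy_equivalent_space_contractibility by blast
  qed
qed

lemma contractible_graph_realization:
  assumes "finite_tree V E"
  shows "contractible_space (graph_realization V E)"
proof -
  have "finite V" using assms by (simp add: finite_tree_def)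
  from contractible_partial_realization[OF assms order_refl this]
  show ?thesis by (simp add: graph_realization_def partial_realization_def)
qed

section \<open>Collapsing contractible subspaces joined by arcs\<close>

text \<open>
  The final map \<open>H (1, _)\<close> factors through \<open>p\<close>, and the factor is a homotopy inverse: \<open>H\<close> itself is
  one of the homotopies, and the map that it induces on \<open>R\<close> is the other one. The
  latter is continuous because the product of \<open>p\<close> with the identity of the interval is again a continuous surjection from a compact
  space to a Hausdorff space, hence a quotient map.
\<close>

lemma homotopy_equivalent_space_quotient:
  assumes Y: "compact_space Y" and R: "Hausdorff_space R"
    and p: "continuous_map Y R p" "p ` topspace Y = topspace R"
    and H: "continuous_map (prod_topology (top_of_set {0..1::real}) Y) Y H"
    and H0: "\<And>x. x \<in> topspace Y \<Longrightarrow> H (0, x) = x"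
    and H1: "\<And>x y. x \<in> topspace Y \<Longrightarrow> y \<in> topspace Y \<Longrightarrow> p x = p y \<Longrightarrow> H (1, x) = H (1, y)"
    and Hp: "\<And>t x y. t \<in> {0..1} \<Longrightarrow> x \<in> topspace Y \<Longrightarrow> y \<in> topspace Y \<Longrightarrow> p x = p y \<Longrightarrow>
      p (H (t, x)) = p (H (t, y))"
  shows "Y homotopy_equivalent_space R"
proof -
  let ?I = "top_of_set {0..1::real}"
  have qp: "quotient_map Y R p" by (rule continuous_imp_quotient_map[OF p(1) Y R p(2)])
  have H1c: "continuous_map Y Y (\<lambda>x. H (1, x))"
    by (rule continuous_map_compose[OF _ H, unfolded o_def]) (auto intro!: continuous_intros)
  obtain s where s: "continuous_map R Y s" "\<And>x. x \<in> topspace Y \<Longrightarrow> s (p x) = H (1, x)"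
  proof (rule quotient_map_lift_exists[OF qp H1c])
    show "H (1, x) = H (1, y)" if "x \<in> topspace Y" "y \<in> topspace Y" "p x = p y" for x y
      using H1 that by blast
  qed (rule that)
  let ?q = "\<lambda>(t, x). (t, p x)"
  have qq: "quotient_map (prod_topology ?I Y) (prod_topology ?I R) ?q"
  proof (rule continuous_imp_quotient_map)
    show "continuous_map (prod_topology ?I Y) (prod_topology ?I R) ?q"
      using p(1) by (simp add: continuous_map_prod_top flip: id_def)
    show "compact_space (prod_topology ?I Y)"
      using Y by (simp add: compact_space_prod_topology compact_space_subtopology)
    show "Hausdorff_space (prod_topology ?I R)"
      using R by (simp add: Hausdorff_space_prod_topology Hausdorff_space_subtopology)
    show "?q ` topspace (prod_topology ?I Y) = topspace (prod_topology ?I R)"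
      using p(2) by (force simp: image_iff)
  qed
  have pH: "continuous_map (prod_topology ?I Y) R (p \<circ> H)"
    by (rule continuous_map_compose[OF H p(1)])
  obtain Q where Q: "continuous_map (prod_topology ?I R) R Q"
    "\<And>z. z \<in> topspace (prod_topology ?I Y) \<Longrightarrow> Q (?q z) = (p \<circ> H) z"
  proof (rule quotient_map_lift_exists[OF qq pH])
    fix z w assume *: "z \<in> topspace (prod_topology ?I Y)" "w \<in> topspace (prod_topology ?I Y)" "?q z = ?q w"
    obtain t x t' y where zw: "z = (t, x)" "w = (t', y)" by (metis surj_pair)
    with * have "t' = t" "t \<in> {0..1}" "x \<in> topspace Y" "y \<in> topspace Y" "p x = p y" by simp_all
    with Hp[of t x y] zw show "(p \<circ> H) z = (p \<circ> H) w" by simp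
  qed (rule that)
  have Q': "Q (t, p x) = p (H (t, x))" if "t \<in> {0..1}" "x \<in> topspace Y" for t x
    using Q(2)[of "(t, x)"] that by simp
  have "homotopic_with (\<lambda>x. True) Y Y id (s \<circ> p)"
    by (subst homotopic_with) (auto intro!: exI[of _ H] H simp: H0 s(2))
  moreover have "homotopic_with (\<lambda>x. True) R R id (p \<circ> s)"
  proof (subst homotopic_with)
    show "\<exists>h. continuous_map (prod_topology ?I R) R h \<and> (\<forall>x\<in>topspace R. h (0, x) = id x) \<and>
      (\<forall>x\<in>topspace R. h (1, x) = (p \<circ> s) x) \<and> (\<forall>t\<in>{0..1}. True)"
    proof (intro exI conjI ballI)
      fix r assume "r \<in> topspace R"
      then obtain x where x: "x \<in> topspace Y" "r = p x" using p(2) by blast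
      show "Q (0, r) = id r" "Q (1, r) = (p \<circ> s) r" using x by (simp_all add: Q' H0 s(2))
    qed (use Q(1) in auto)
  qed auto
  ultimately show ?thesis
    unfolding homotopy_equivalent_space_def
    using p(1) s(1) by (meson homotopic_with_symD)
qed

text \<open>
  The homotopy extension property of an arc relative to its end points. At time \<open>t\<close>, the first and the last
  part of length \<open>t / 3\<close> of the parameter interval run through the prescribed motions of the two end
  points, and the arc is squeezed into the remaining part of length \<open>1 - 2 t / 3\<close>.
\<close>

lemma arc_homotopy:
  assumes D: "continuous_map (prod_topology (top_of_set {0..1::real}) (subtopology Y S)) (subtopology Y S) D"
    and D0: "\<And>x. x \<in> S \<Longrightarrow> D (0, x) = x"
    and E: "continuous_map (prod_topology (top_of_set {0..1::real}) (subtopology Y T)) (subtopology Y T) E"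
    and E0: "\<And>x. x \<in> T \<Longrightarrow> E (0, x) = x"
    and a: "pathin Y a" and ends: "a 0 \<in> S" "a 1 \<in> T"
    and ST: "S \<subseteq> topspace Y" "T \<subseteq> topspace Y"
  obtains h where "continuous_map (prod_topology (top_of_set {0..1::real}) (top_of_set {0..1::real})) Y h"
    "\<And>u. u \<in> {0..1} \<Longrightarrow> h (0, u) = a u"
    "\<And>t. t \<in> {0..1} \<Longrightarrow> h (t, 0) = D (t, a 0)"
    "\<And>t. t \<in> {0..1} \<Longrightarrow> h (t, 1) = E (t, a 1)"
proof -
  let ?I = "top_of_set {0..1::real}"
  let ?P = "prod_topology ?I ?I"
  define h where "h = (\<lambda>z. if 3 * snd z \<le> fst z then D (fst z - 3 * snd z, a 0)
    else if 3 - 3 * snd z \<le> fst z then E (fst z - (3 - 3 * snd z), a 1)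
    else a ((3 * snd z - fst z) / (3 - 2 * fst z)))"
  have P_eq: "?P = top_of_set ({0..1} \<times> {0..1})" by simp
  have real: "continuous_map (subtopology ?P U) euclideanreal g"
    if "continuous_on ({0..1} \<times> {0..1}) g" for g :: "real \<times> real \<Rightarrow> real" and U
    using that unfolding P_eq by (simp add: subtopology_subtopology continuous_on_subset)
  have real': "continuous_map ?P euclideanreal g"
    if "continuous_on ({0..1} \<times> {0..1}) g" for g :: "real \<times> real \<Rightarrow> real"
    using that unfolding P_eq by simp
  have into: "continuous_map (subtopology ?P U) ?I g"
    if "continuous_on ({0..1} \<times> {0..1}) g" "\<And>z. z \<in> {0..1} \<times> {0..1} \<Longrightarrow> z \<in> U \<Longrightarrow> g z \<in> {0..1}"
    for g :: "real \<times> real \<Rightarrow> real" and U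
    using real[OF that(1), of U] that(2) by (auto simp: continuous_map_in_subtopology)
  have tail: "continuous_map (subtopology ?P U) Y (\<lambda>z. F (g z, b))"
    if F: "continuous_map (prod_topology ?I (subtopology Y V)) (subtopology Y V) F" and b: "b \<in> V" "V \<subseteq> topspace Y"
      and g: "continuous_map (subtopology ?P U) ?I g" for F V b g U
  proof -
    have "continuous_map (subtopology ?P U) (prod_topology ?I (subtopology Y V)) (\<lambda>z. (g z, b))"
      using g b by (intro continuous_map_pairedI) (auto simp: continuous_map_const)
    from continuous_map_compose[OF this F] show ?thesis
      by (simp add: o_def continuous_map_in_subtopology)
  qed
  have cont: "continuous_map ?P Y h"
    unfolding h_def
  proof (rule continuous_map_cases_le)
    show "continuous_map ?P euclideanreal (\<lambda>z. 3 * snd z)" "continuous_map ?P euclideanreal fst"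
      by (intro real' continuous_intros)+
    show "continuous_map (subtopology ?P {z \<in> topspace ?P. 3 * snd z \<le> fst z}) Y (\<lambda>z. D (fst z - 3 * snd z, a 0))"
      by (intro tail[OF D ends(1) ST(1)] into continuous_intros) auto
    show "continuous_map (subtopology ?P {z \<in> topspace ?P. fst z \<le> 3 * snd z}) Y
      (\<lambda>z. if 3 - 3 * snd z \<le> fst z then E (fst z - (3 - 3 * snd z), a 1)
        else a ((3 * snd z - fst z) / (3 - 2 * fst z)))"
    proof (rule continuous_map_cases_le)
      show "continuous_map (subtopology ?P {z \<in> topspace ?P. fst z \<le> 3 * snd z}) euclideanreal (\<lambda>z. 3 - 3 * snd z)"
        "continuous_map (subtopology ?P {z \<in> topspace ?P. fst z \<le> 3 * snd z}) euclideanreal fst"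
        by (intro real continuous_intros)+
      show "continuous_map (subtopology (subtopology ?P {z \<in> topspace ?P. fst z \<le> 3 * snd z})
         {z \<in> topspace (subtopology ?P {z \<in> topspace ?P. fst z \<le> 3 * snd z}). 3 - 3 * snd z \<le> fst z}) Y
         (\<lambda>z. E (fst z - (3 - 3 * snd z), a 1))"
        unfolding subtopology_subtopology
        by (intro tail[OF E ends(2) ST(2)] into continuous_intros) auto
      have "continuous_on ({0..1} \<times> {0..1}) (\<lambda>z::real \<times> real. (3 * snd z - fst z) / (3 - 2 * fst z))"
        by (intro continuous_intros) auto
      then have "continuous_map (subtopology ?P ({z \<in> topspace ?P. fst z \<le> 3 * snd z} \<inter>
         {z \<in> topspace (subtopology ?P {z \<in> topspace ?P. fst z \<le> 3 * snd z}). fst z \<le> 3 - 3 * snd z})) ?I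
          (\<lambda>z. (3 * snd z - fst z) / (3 - 2 * fst z))"
        by (rule into) (auto simp: divide_simps)
      from continuous_map_compose[OF this a[unfolded pathin_def]]
      show "continuous_map (subtopology (subtopology ?P {z \<in> topspace ?P. fst z \<le> 3 * snd z})
         {z \<in> topspace (subtopology ?P {z \<in> topspace ?P. fst z \<le> 3 * snd z}). fst z \<le> 3 - 3 * snd z}) Y
         (\<lambda>z. a ((3 * snd z - fst z) / (3 - 2 * fst z)))"
        unfolding subtopology_subtopology o_def .
      fix z assume z: "z \<in> topspace (subtopology ?P {z \<in> topspace ?P. fst z \<le> 3 * snd z})" "3 - 3 * snd z = fst z"
      then have "(3 * snd z - fst z) / (3 - 2 * fst z) = 1" by (auto simp: divide_simps)
      moreover have "fst z - (3 - 3 * snd z) = 0" using z(2) by simp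
      ultimately show "E (fst z - (3 - 3 * snd z), a 1) = a ((3 * snd z - fst z) / (3 - 2 * fst z))"
        using E0 ends by (simp only:)
    qed
    fix z assume z: "z \<in> topspace ?P" "3 * snd z = fst z"
    then have "\<not> 3 - 3 * snd z \<le> fst z" by (cases z) auto
    then show "D (fst z - 3 * snd z, a 0) = (if 3 - 3 * snd z \<le> fst z then E (fst z - (3 - 3 * snd z), a 1)
        else a ((3 * snd z - fst z) / (3 - 2 * fst z)))"
      using z(2) D0 ends by simp
  qed
  show thesis
  proof (rule that[OF cont])
    show "h (0, u) = a u" if "u \<in> {0..1}" for u
    proof -
      have "u = 0 \<or> u = 1 \<or> (0 < u \<and> u < 1)" using that by auto
      then show ?thesis using D0 E0 ends by (auto simp: h_def)
    qed
    show "h (t, 0) = D (t, a 0)" "h (t, 1) = E (t, a 1)" if "t \<in> {0..1}" for t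
      using that by (auto simp: h_def)
  qed
qed

text \<open>
  On each \<open>T\<close> the homotopy is a contraction of \<open>T\<close>, and on each arc it is the extension given by
  \<open>arc_homotopy\<close>. These finitely many pieces have closed domains and agree on overlaps, since distinct
  arcs share at most end points, which lie in the sets \<open>T\<close>.
\<close>

lemma collapse_homotopy:
  fixes Y :: "'a topology" and \<T> :: "'a set set" and J :: "'j set" and a :: "'j \<Rightarrow> real \<Rightarrow> 'a"
  assumes Y: "Hausdorff_space Y"
    and fin: "finite \<T>" "finite J"
    and clo: "\<And>T. T \<in> \<T> \<Longrightarrow> closedin Y T"
    and disj: "\<And>S T x. S \<in> \<T> \<Longrightarrow> T \<in> \<T> \<Longrightarrow> x \<in> S \<Longrightarrow> x \<in> T \<Longrightarrow> S = T"
    and contr: "\<And>T. T \<in> \<T> \<Longrightarrow> contractible_space (subtopology Y T)"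
    and path: "\<And>j. j \<in> J \<Longrightarrow> pathin Y (a j)" and inj: "\<And>j. j \<in> J \<Longrightarrow> inj_on (a j) {0..1}"
    and ends: "\<And>j. j \<in> J \<Longrightarrow> a j 0 \<in> \<Union>\<T>" "\<And>j. j \<in> J \<Longrightarrow> a j 1 \<in> \<Union>\<T>"
    and interior: "\<And>j u. j \<in> J \<Longrightarrow> u \<in> {0<..<1} \<Longrightarrow> a j u \<notin> \<Union>\<T>"
    and adisj: "\<And>j k u v. j \<in> J \<Longrightarrow> k \<in> J \<Longrightarrow> u \<in> {0<..<1} \<Longrightarrow> v \<in> {0<..<1} \<Longrightarrow> a j u = a k v \<Longrightarrow> j = k"
    and cover: "topspace Y = \<Union>\<T> \<union> (\<Union>j\<in>J. a j ` {0..1})"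
  obtains H where "continuous_map (prod_topology (top_of_set {0..1::real}) Y) Y H"
    "\<And>x. x \<in> topspace Y \<Longrightarrow> H (0, x) = x"
    "\<And>T t x. T \<in> \<T> \<Longrightarrow> t \<in> {0..1} \<Longrightarrow> x \<in> T \<Longrightarrow> H (t, x) \<in> T"
    "\<And>T x y. T \<in> \<T> \<Longrightarrow> x \<in> T \<Longrightarrow> y \<in> T \<Longrightarrow> H (1, x) = H (1, y)"
proof -
  let ?I = "top_of_set {0..1::real}"
  let ?P = "prod_topology ?I Y"
  have Tsub: "T \<subseteq> topspace Y" if "T \<in> \<T>" for T using clo[OF that] closedin_subset by blast
  have "\<exists>D. continuous_map (prod_topology ?I (subtopology Y T)) (subtopology Y T) D \<and>
      (\<forall>x\<in>T. D (0, x) = x) \<and> (\<exists>b. \<forall>x\<in>T. D (1, x) = b)" if "T \<in> \<T>" for T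
  proof -
    obtain b where "homotopic_with (\<lambda>x. True) (subtopology Y T) (subtopology Y T) id (\<lambda>x. b)"
      using contr[OF \<open>T \<in> \<T>\<close>] unfolding contractible_space_def by (rule exE)
    then obtain D where "continuous_map (prod_topology ?I (subtopology Y T)) (subtopology Y T) D"
      "\<forall>x. D (0, x) = id x" "\<forall>x. D (1, x) = b"
      unfolding homotopic_with_def by blast
    then show ?thesis by (intro exI[of _ D]) auto
  qed
  then have "\<forall>T\<in>\<T>. \<exists>D. continuous_map (prod_topology ?I (subtopology Y T)) (subtopology Y T) D \<and>
      (\<forall>x\<in>T. D (0, x) = x) \<and> (\<exists>b. \<forall>x\<in>T. D (1, x) = b)" by blast
  from bchoice[OF this] obtain D where D: "\<forall>T\<in>\<T>. continuous_map (prod_topology ?I (subtopology Y T)) (subtopology Y T) (D T) \<and>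
      (\<forall>x\<in>T. D T (0, x) = x) \<and> (\<exists>b. \<forall>x\<in>T. D T (1, x) = b)" ..
  have Dcont: "continuous_map (prod_topology ?I (subtopology Y T)) (subtopology Y T) (D T)"
    and D0: "\<And>x. x \<in> T \<Longrightarrow> D T (0, x) = x" and D1: "\<And>x y. x \<in> T \<Longrightarrow> y \<in> T \<Longrightarrow> D T (1, x) = D T (1, y)"
    if "T \<in> \<T>" for T
    using bspec[OF D that] by auto
  have Din: "D T (t, x) \<in> T" if "T \<in> \<T>" "t \<in> {0..1}" "x \<in> T" for T t x
  proof -
    have "(t, x) \<in> topspace (prod_topology ?I (subtopology Y T))" using that Tsub by auto
    then have "D T (t, x) \<in> topspace (subtopology Y T)"
      using Dcont[OF that(1)] continuous_map_image_subset_topspace by blast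
    then show ?thesis by simp
  qed
  have "\<exists>h. continuous_map (prod_topology ?I ?I) Y h \<and> (\<forall>u\<in>{0..1}. h (0, u) = a j u) \<and>
      (\<forall>T\<in>\<T>. \<forall>t\<in>{0..1}. \<forall>u\<in>{0..1}. a j u \<in> T \<longrightarrow> h (t, u) = D T (t, a j u))" if j: "j \<in> J" for j
  proof -
    obtain S T where S: "S \<in> \<T>" "a j 0 \<in> S" and T: "T \<in> \<T>" "a j 1 \<in> T" using ends[OF j] by blast
    obtain h where h: "continuous_map (prod_topology ?I ?I) Y h"
      "\<And>u. u \<in> {0..1} \<Longrightarrow> h (0, u) = a j u"
      "\<And>t. t \<in> {0..1} \<Longrightarrow> h (t, 0) = D S (t, a j 0)"
      "\<And>t. t \<in> {0..1} \<Longrightarrow> h (t, 1) = D T (t, a j 1)"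
      by (rule arc_homotopy[OF Dcont[OF S(1)] D0[OF S(1)] Dcont[OF T(1)] D0[OF T(1)] path[OF j] S(2) T(2)
          Tsub[OF S(1)] Tsub[OF T(1)]]) (assumption | rule that)+
    have "h (t, u) = D U (t, a j u)" if U: "U \<in> \<T>" "t \<in> {0..1}" "u \<in> {0..1}" "a j u \<in> U" for U t u
    proof -
      have "u \<notin> {0<..<1}" using interior[OF j, of u] U by blast
      then have "u = 0 \<or> u = 1" using U(3) by auto
      then show ?thesis using h(3,4) U S T disj by metis
    qed
    then show ?thesis using h(1,2) by (intro exI[of _ h] conjI ballI impI)
  qed
  then have "\<forall>j\<in>J. \<exists>h. continuous_map (prod_topology ?I ?I) Y h \<and> (\<forall>u\<in>{0..1}. h (0, u) = a j u) \<and>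
      (\<forall>T\<in>\<T>. \<forall>t\<in>{0..1}. \<forall>u\<in>{0..1}. a j u \<in> T \<longrightarrow> h (t, u) = D T (t, a j u))" by (rule ballI)
  from bchoice[OF this] obtain h where h: "\<forall>j\<in>J. continuous_map (prod_topology ?I ?I) Y (h j) \<and>
      (\<forall>u\<in>{0..1}. h j (0, u) = a j u) \<and>
      (\<forall>T\<in>\<T>. \<forall>t\<in>{0..1}. \<forall>u\<in>{0..1}. a j u \<in> T \<longrightarrow> h j (t, u) = D T (t, a j u))" ..
  define w where "w = (\<lambda>j. inv_into {0..1} (a j))"
  have wa: "w j (a j u) = u" if "j \<in> J" "u \<in> {0..1}" for j u
    using inj that by (simp add: w_def)
  have img: "compactin Y (a j ` {0..1})" if "j \<in> J" for j
    using path[OF that] unfolding pathin_def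
    by (rule image_compactin[rotated]) (simp add: compactin_subtopology)
  have wcont: "continuous_map (subtopology Y (a j ` {0..1})) ?I (w j)" if j: "j \<in> J" for j
  proof -
    have sub: "a j ` {0..1} \<subseteq> topspace Y" using img[OF j] compactin_subset_topspace by blast
    have "homeomorphic_map ?I (subtopology Y (a j ` {0..1})) (a j)"
    proof (rule continuous_imp_homeomorphic_map)
      show "continuous_map ?I (subtopology Y (a j ` {0..1})) (a j)"
        using path[OF j] by (auto simp: pathin_def continuous_map_in_subtopology)
    qed (use inj[OF j] Y sub in \<open>auto simp: compact_space_subtopology Hausdorff_space_subtopology\<close>)
    then obtain g where g: "homeomorphic_maps ?I (subtopology Y (a j ` {0..1})) (a j) g"
      using homeomorphic_map_maps by blast
    then have "continuous_map (subtopology Y (a j ` {0..1})) ?I g" by (simp add: homeomorphic_maps_def)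
    then show ?thesis
      by (rule continuous_map_eq) (use g wa[OF j] in \<open>auto simp: homeomorphic_maps_def\<close>)
  qed
  \<comment> \<open>the closed pieces, indexed by the sets \<open>T\<close> and by the arcs, and the homotopy on each of them\<close>
  define S where "S = (\<lambda>i. case i of Inl T \<Rightarrow> T | Inr j \<Rightarrow> a j ` {0..1})"
  define F where "F = (\<lambda>i. case i of Inl T \<Rightarrow> D T | Inr j \<Rightarrow> (\<lambda>z. h j (fst z, w j (snd z))))"
  let ?K = "Inl ` \<T> \<union> Inr ` J"
  have F_T: "F i (t, x) = D T (t, x)" if iK: "i \<in> ?K" and xi: "x \<in> S i" and xT: "T \<in> \<T>" "x \<in> T" and t: "t \<in> {0..1}" for i T t x
  proof (cases i)
    case (Inl T')
    then have "T' \<in> \<T>" "x \<in> T'" using that by (auto simp: S_def)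
    then have "T' = T" using disj that(3,4) by blast
    then show ?thesis using Inl by (simp add: F_def)
  next
    case (Inr j)
    then have "j \<in> J" "x \<in> a j ` {0..1}" using iK xi by (auto simp: S_def)
    then obtain u where u: "j \<in> J" "u \<in> {0..1}" "x = a j u" by blast
    then have "h j (t, u) = D T (t, a j u)" using h xT t by blast
    then show ?thesis using u Inr wa by (simp add: F_def)
  qed
  obtain H where H: "continuous_map ?P Y H"
    "\<And>z i. i \<in> ?K \<Longrightarrow> z \<in> topspace ?P \<inter> ({0..1} \<times> S i) \<Longrightarrow> H z = F i z"
  proof (rule pasting_lemma_exists_closed[where X = ?P and Y = Y and I = ?K and T = "\<lambda>i. {0..1} \<times> S i" and f = F])
    show "finite ?K" using fin by simp
    show "topspace ?P \<subseteq> \<Union> ((\<lambda>i. {0..1} \<times> S i) ` ?K)"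
      using cover by (auto simp: S_def)
    fix i assume i: "i \<in> ?K"
    have "closedin Y (S i)"
      using i clo img Y by (auto simp: S_def compactin_imp_closedin)
    then show "closedin ?P ({0..1} \<times> S i)"
      by (auto simp: closedin_prod_Times_iff)
    show "continuous_map (subtopology ?P ({0..1} \<times> S i)) Y (F i)"
    proof (cases i)
      case (Inl T)
      then have "T \<in> \<T>" using i by auto
      then show ?thesis
        using Dcont[of T] Inl by (simp add: subtopology_Times S_def F_def subtopology_subtopology continuous_map_in_subtopology)
    next
      case (Inr j)
      then have j: "j \<in> J" using i by auto
      have "continuous_map (prod_topology ?I (subtopology Y (a j ` {0..1}))) (prod_topology ?I ?I) (\<lambda>z. (fst z, w j (snd z)))"
        by (intro continuous_map_pairedI continuous_map_fst
            continuous_map_compose[OF continuous_map_snd wcont[OF j], unfolded o_def])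
      moreover have "continuous_map (prod_topology ?I ?I) Y (h j)" using h j by blast
      ultimately have "continuous_map (prod_topology ?I (subtopology Y (a j ` {0..1}))) Y (h j \<circ> (\<lambda>z. (fst z, w j (snd z))))"
        by (rule continuous_map_compose)
      then show ?thesis
        using Inr by (simp add: subtopology_Times S_def F_def subtopology_subtopology o_def del: prod_topology_subtopology_eu)
    qed
  next
    fix i k z assume i: "i \<in> ?K" and k: "k \<in> ?K" and z: "z \<in> topspace ?P \<inter> ({0..1} \<times> S i) \<inter> ({0..1} \<times> S k)"
    obtain t x where tx: "z = (t, x)" "t \<in> {0..1}" "x \<in> S i" "x \<in> S k" using z by auto
    show "F i z = F k z"
    proof (cases "x \<in> \<Union>\<T>")
      case True
      then obtain T where "T \<in> \<T>" "x \<in> T" by blast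
      then show ?thesis using F_T[OF i tx(3)] F_T[OF k tx(4)] tx by simp
    next
      case False
      have arc: "\<exists>j u. i = Inr j \<and> j \<in> J \<and> u \<in> {0<..<1} \<and> x = a j u" if iK: "i \<in> ?K" "x \<in> S i" for i
      proof -
        obtain j where j: "i = Inr j" "j \<in> J" using iK False by (auto simp: S_def)
        then obtain u where u: "u \<in> {0..1}" "x = a j u" using iK(2) by (auto simp: S_def)
        then have "u \<noteq> 0" "u \<noteq> 1" using False ends j by auto
        then have "u \<in> {0<..<1}" using u by auto
        then show ?thesis using j u by blast
      qed
      obtain j u j' u' where "i = Inr j" "j \<in> J" "u \<in> {0<..<1}" "x = a j u"
        "k = Inr j'" "j' \<in> J" "u' \<in> {0<..<1}" "x = a j' u'" using arc[OF i tx(3)] arc[OF k tx(4)] by blast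
      then have "i = k" using adisj by metis
      then show ?thesis by simp
    qed
  qed (rule that)
  have H_T: "H (t, x) = D T (t, x)" if "T \<in> \<T>" "t \<in> {0..1}" "x \<in> T" for T t x
  proof -
    have "H (t, x) = F (Inl T) (t, x)" using that Tsub by (intro H(2)) (auto simp: S_def)
    then show ?thesis by (simp add: F_def)
  qed
  show thesis
  proof (rule that[OF H(1)])
    show "H (t, x) \<in> T" if "T \<in> \<T>" "t \<in> {0..1}" "x \<in> T" for T t x
      using H_T[OF that] Din[OF that] by simp
    show "H (1, x) = H (1, y)" if "T \<in> \<T>" "x \<in> T" "y \<in> T" for T x y
      using H_T[OF that(1) _ that(2), of 1] H_T[OF that(1) _ that(3), of 1] D1[OF that] by simp
    fix x assume x: "x \<in> topspace Y"
    show "H (0, x) = x"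
    proof (cases "x \<in> \<Union>\<T>")
      case True
      then obtain T where "T \<in> \<T>" "x \<in> T" by blast
      then show ?thesis using H_T[of T 0 x] D0[of T x] by simp
    next
      case False
      then obtain j u where ju: "j \<in> J" "u \<in> {0..1}" "x = a j u" using cover x by auto
      then have "H (0, x) = F (Inr j) (0, x)" using x by (intro H(2)) (auto simp: S_def)
      then show ?thesis using ju h wa by (simp add: F_def)
    qed
  qed
qed

section \<open>The graph of critical points and the Reeb graph\<close>

lemma realization_vertex_in_graph_realization:
  assumes "finite V" "v \<in> V"
  shows "realization_vertex V v \<in> topspace (graph_realization V E)"
proof -
  have "{w \<in> V. realization_vertex V v w \<noteq> 0} = {v}"
    using assms by (auto simp: realization_vertex_def)
  moreover have "(\<Sum>w\<in>V. realization_vertex V v w) = 1"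
    using assms by (simp add: realization_vertex_def)
  ultimately show ?thesis
    using assms by (auto simp: graph_realization_def realization_vertex_def PiE_def)
qed

lemma spanning_tree_properties:
  assumes "spanning_tree X A f K T"
  shows "T \<subseteq> K" and "K \<inter> Cr A f \<subseteq> T" and "contractible_space (subtopology X T)"
    and "closedin X K \<Longrightarrow> closedin X T"
proof -
  have clo: "closedin (subtopology X K) T" using assms by (simp add: spanning_tree_def)
  obtain E h where tree: "finite_tree (K \<inter> Cr A f) E"
    and h: "homeomorphic_map (graph_realization (K \<inter> Cr A f) E) (subtopology X T) h"
    and vert: "\<forall>v\<in>K \<inter> Cr A f. h (realization_vertex (K \<inter> Cr A f) v) = v"
    using assms unfolding spanning_tree_def by blast
  show "T \<subseteq> K" using closedin_subset[OF clo] by simp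
  show "closedin X T" if "closedin X K" using closedin_trans_full[OF clo that] .
  show "K \<inter> Cr A f \<subseteq> T"
  proof
    fix v assume v: "v \<in> K \<inter> Cr A f"
    have "finite (K \<inter> Cr A f)" using tree by (simp add: finite_tree_def)
    then have "realization_vertex (K \<inter> Cr A f) v \<in> topspace (graph_realization (K \<inter> Cr A f) E)"
      using v by (rule realization_vertex_in_graph_realization)
    then have "h (realization_vertex (K \<inter> Cr A f) v) \<in> topspace (subtopology X T)"
      using homeomorphic_imp_surjective_map[OF h] by blast
    then show "v \<in> T" using vert v by simp
  qed
  show "contractible_space (subtopology X T)"
    using contractible_graph_realization[OF tree] homeomorphic_map_imp_homeomorphic_space[OF h]
      homeomorphic_space_contractibility by blast
qed

context finite_critical
begin

text \<open>
  Fix critical values \<open>c < c'\<close> and a value \<open>t\<close> between them that is not critical. The level at \<open>t\<close> is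
  compact and covered by the open edges through its points, so finitely many edges cover it, and
  each component of type (IIa) for \<open>c\<close> and \<open>c'\<close> is one of these, as it reaches the value \<open>t\<close>.
\<close>

lemma finite_type_IIa: "finite {C. \<exists>c c'. type_IIa X A f c c' C}"
proof -
  have fin: "finite {C. type_IIa X A f c c' C}" if "c < c'" for c c'
  proof -
    have "infinite ({c<..<c'} - f ` Cr A f)"
      using that finite_crit by (simp add: Diff_infinite_finite infinite_Ioo)
    then obtain t where t: "c < t" "t < c'" "t \<notin> f ` Cr A f"
      by (metis DiffE ex_in_conv finite.emptyI greaterThanLessThan_iff)
    have reg: "x \<in> topspace X" "lc x \<inter> Cr A f = {}" if x: "x \<in> level X f t" for x
    proof -
      show "x \<in> topspace X" using x by (simp add: level_def)
      have "f z = t" if "z \<in> lc x" for z using x lc_sub[OF that] by (simp add: level_def)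
      then show "lc x \<inter> Cr A f = {}" using t(3) by blast
    qed
    have "compactin X (level X f t)" using closed_level compact closedin_compact_space by blast
    moreover have "(\<forall>W\<in>edge ` level X f t. openin X W) \<and> level X f t \<subseteq> \<Union>(edge ` level X f t)"
      using tube_edge[OF reg] by (auto simp: tube_def)
    ultimately obtain \<F> where "finite \<F>" "\<F> \<subseteq> edge ` level X f t" "level X f t \<subseteq> \<Union>\<F>"
      unfolding compactin_def by meson
    then obtain P where P: "finite P" "P \<subseteq> level X f t" "level X f t \<subseteq> \<Union>(edge ` P)"
      by (metis finite_subset_image)
    have "{C. type_IIa X A f c c' C} \<subseteq> edge ` P"
    proof
      fix C assume "C \<in> {C. type_IIa X A f c c' C}"
      then have C: "type_IIa X A f c c' C" by simp
      then have "C \<noteq> {}" using nonempty_connected_components_of by (force simp: type_IIa_def)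
      then have "f ` C = {c<..<c'}" using type_IIa_is_edge(4)[OF C] by blast
      then have "t \<in> f ` C" using t by simp
      then obtain x where x: "x \<in> C" "f x = t" by blast
      then have "x \<in> level X f t" using type_IIa_is_edge(1)[OF C] by (simp add: level_def)
      then obtain p where p: "p \<in> P" "x \<in> edge p" using P by blast
      then have "edge x = edge p" using edge_unique[OF reg, of p x] P(2) by blast
      then show "C \<in> edge ` P" using type_IIa_is_edge(3)[OF C x(1)] p by blast
    qed
    then show ?thesis using P(1) finite_surj by blast
  qed
  define Q where "Q = {p \<in> f ` Cr A f \<times> f ` Cr A f. fst p < snd p}"
  have "{C. \<exists>c c'. type_IIa X A f c c' C} \<subseteq> (\<Union>p\<in>Q. {C. type_IIa X A f (fst p) (snd p) C})"
  proof
    fix C assume "C \<in> {C. \<exists>c c'. type_IIa X A f c c' C}"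
    then obtain c c' where C: "type_IIa X A f c c' C" by blast
    then have "(c, c') \<in> Q" unfolding type_IIa_def Q_def by simp
    then show "C \<in> (\<Union>p\<in>Q. {C. type_IIa X A f (fst p) (snd p) C})" using C by force
  qed
  moreover have "finite (\<Union>p\<in>Q. {C. type_IIa X A f (fst p) (snd p) C})"
    using finite_crit fin by (auto simp: Q_def)
  ultimately show ?thesis by (rule finite_subset)
qed

lemma type_IIa_disjoint_essential:
  assumes "type_IIa X A f c c' C" "x \<in> C" "k \<in> Cr A f"
  shows "x \<notin> lc k"
proof
  assume "x \<in> lc k"
  then have "lc x = lc k" by (rule level_component_eq)
  moreover have "k \<in> lc k" using assms(3) crit_subset in_level_component[of k X f] by blast
  ultimately show False using type_IIa_is_edge(2)[OF assms(1,2)] assms(3) by blast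
qed

text \<open>
  By the intermediate value theorem the path attains the value \<open>f x\<close>, and at this level \<open>C\<close> has only one
  component.
\<close>

lemma decreasing_edge_path_meets_level_component:
  assumes C: "type_IIa X A f c c' C" and x: "x \<in> C"
    and K: "K \<in> essential_components X A f c" "K' \<in> essential_components X A f c'"
    and g: "decreasing_edge_path X f C K K' \<gamma>"
  shows "\<exists>u\<in>{0<..<1}. lc (\<gamma> u) = lc x"
proof -
  note E = type_IIa_is_edge[OF C x]
  have path: "pathin X \<gamma>" and ends: "\<gamma> 0 \<in> K'" "\<gamma> 1 \<in> K" and int: "\<gamma> ` {0<..<1} \<subseteq> C"
    using g by (auto simp: decreasing_edge_path_def)
  have f01: "f (\<gamma> 0) = c'" "f (\<gamma> 1) = c"
    using ends K lc_sub unfolding essential_components_iff by blast+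
  have fx: "c < f x" "f x < c'" using E(4) x by auto
  have "continuous_map (top_of_set {0..1}) euclideanreal (f \<circ> \<gamma>)"
    using path cont unfolding pathin_def by (rule continuous_map_compose)
  then have "continuous_on {0..1} (f \<circ> \<gamma>)" by simp
  then obtain u where u: "0 \<le> u" "u \<le> 1" "(f \<circ> \<gamma>) u = f x"
    using IVT2'[of "f \<circ> \<gamma>" 1 "f x" 0] fx f01 by auto
  have "u \<noteq> 0" "u \<noteq> 1" using u(3) f01 fx by auto
  then have u01: "u \<in> {0<..<1}" using u by auto
  then have "\<gamma> u \<in> C" using int by blast
  then have "\<gamma> u \<in> lc x"
    using u(3) tube_edge[OF E(1,2)] x E(3) by (auto simp: tube_def)
  then show ?thesis using level_component_eq u01 by metis
qed

text \<open>
  The restriction of the quotient map to \<open>G\<close> is onto, as each component of type (IIa) is crossed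
  by its edge-path. It is injective up to the trees, as the edge-paths are strictly monotone for \<open>f\<close> and
  distinct components of type (IIa) are disjoint.
\<close>

theorem Gamma_homotopy_equivalent_reeb_graph:
  assumes "is_Gamma X A f G"
  shows "(subtopology X G) homotopy_equivalent_space (reeb_graph X f)"
proof -
  obtain T \<gamma> where T: "\<forall>c. \<forall>K\<in>essential_components X A f c. spanning_tree X A f K (T K)"
    and \<gamma>: "\<forall>c c' C. type_IIa X A f c c' C \<longrightarrow>
           (\<exists>K\<in>essential_components X A f c. \<exists>K'\<in>essential_components X A f c'.
              decreasing_edge_path X f C K K' (\<gamma> C) \<and>
              \<gamma> C 0 \<in> Cr A f \<inter> (X closure_of C) \<inter> K' \<and>
              \<gamma> C 1 \<in> Cr A f \<inter> (X closure_of C) \<inter> K)"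
    and G: "G = Cr A f \<union> (\<Union>c. \<Union>K\<in>essential_components X A f c. T K) \<union>
            \<Union>{\<gamma> C ` {0..1} | c c' C. type_IIa X A f c c' C}"
    using assms unfolding is_Gamma_def by blast
  define J where "J = {C. \<exists>c c'. type_IIa X A f c c' C}"
  define \<T> where "\<T> = (\<lambda>k. T (lc k)) ` Cr A f"
  have self: "k \<in> lc k" if "k \<in> topspace X" for k using that in_level_component by fast
  have Tk: "spanning_tree X A f (lc k) (T (lc k))" if "k \<in> Cr A f" for k
  proof -
    have "lc k \<in> essential_components X A f (f k)" using that essential_components_iff by blast
    then show ?thesis using T by blast
  qed
  note Tprop = spanning_tree_properties[OF Tk]
  have crit_in_T: "k \<in> T (lc k)" if "k \<in> Cr A f" for k
    using Tprop(2)[OF that] self that crit_subset by blast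
  have crit_T: "Cr A f \<subseteq> \<Union>\<T>" using crit_in_T by (auto simp: \<T>_def)
  have T_lc: "lc x = lc k" if "k \<in> Cr A f" "x \<in> T (lc k)" for x k
    by (rule level_component_eq[OF subsetD[OF Tprop(1)[OF that(1)] that(2)]])
  have edge_path: "pathin X (\<gamma> C)" "\<gamma> C 0 \<in> Cr A f" "\<gamma> C 1 \<in> Cr A f" "\<gamma> C ` {0<..<1} \<subseteq> C"
    "\<And>s t. s \<in> {0..1} \<Longrightarrow> t \<in> {0..1} \<Longrightarrow> s > t \<Longrightarrow> f (\<gamma> C s) < f (\<gamma> C t)"
    "\<And>x. x \<in> C \<Longrightarrow> \<exists>u\<in>{0<..<1}. lc (\<gamma> C u) = lc x"
    if C: "C \<in> J" for C
  proof -
    obtain c c' where IIa: "type_IIa X A f c c' C" using C by (auto simp: J_def)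
    then obtain K K' where K: "K \<in> essential_components X A f c" "K' \<in> essential_components X A f c'"
      and dec: "decreasing_edge_path X f C K K' (\<gamma> C)"
      and ends: "\<gamma> C 0 \<in> Cr A f" "\<gamma> C 1 \<in> Cr A f"
      using \<gamma> by blast
    show "\<gamma> C 0 \<in> Cr A f" "\<gamma> C 1 \<in> Cr A f" by (fact ends)+
    show "pathin X (\<gamma> C)" "\<gamma> C ` {0<..<1} \<subseteq> C"
      "\<And>s t. s \<in> {0..1} \<Longrightarrow> t \<in> {0..1} \<Longrightarrow> s > t \<Longrightarrow> f (\<gamma> C s) < f (\<gamma> C t)"
      using dec unfolding decreasing_edge_path_def by blast+
    show "\<exists>u\<in>{0<..<1}. lc (\<gamma> C u) = lc x" if "x \<in> C" for x
      by (rule decreasing_edge_path_meets_level_component[OF IIa that K dec])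
  qed
  have J_edge: "x \<in> topspace X" "lc x \<inter> Cr A f = {}" "C = edge x" if "C \<in> J" "x \<in> C" for C x
    using that type_IIa_is_edge unfolding J_def by blast+
  have J_disj: "x \<notin> \<Union>\<T>" if "C \<in> J" "x \<in> C" for C x
    using that type_IIa_disjoint_essential Tprop(1) unfolding J_def \<T>_def by blast
  have inj: "inj_on (f \<circ> \<gamma> C) {0..1}" if "C \<in> J" for C
    by (rule linorder_inj_onI') (use edge_path(5)[OF that] in force)
  have G_eq: "G = \<Union>\<T> \<union> (\<Union>C\<in>J. \<gamma> C ` {0..1})"
  proof -
    have trees: "(\<Union>c. \<Union>K\<in>essential_components X A f c. T K) = \<Union>\<T>"
    proof
      show "(\<Union>c. \<Union>K\<in>essential_components X A f c. T K) \<subseteq> \<Union>\<T>"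
        unfolding \<T>_def by (auto simp: essential_components_iff)
      have "lc k \<in> essential_components X A f (f k)" if "k \<in> Cr A f" for k
        using that essential_components_iff by blast
      then show "\<Union>\<T> \<subseteq> (\<Union>c. \<Union>K\<in>essential_components X A f c. T K)"
        unfolding \<T>_def by blast
    qed
    have arcs: "\<Union>{\<gamma> C ` {0..1} | c c' C. type_IIa X A f c c' C} = (\<Union>C\<in>J. \<gamma> C ` {0..1})"
      by (auto simp: J_def)
    show ?thesis unfolding G trees arcs by (simp only: Un_absorb1[OF crit_T])
  qed
  have finJ: "finite J" using finite_type_IIa by (simp add: J_def)
  have finT: "finite \<T>" using finite_crit by (simp add: \<T>_def)
  have cloT: "closedin X S" if "S \<in> \<T>" for S
    using that Tprop(4)[OF _ closed_lc] unfolding \<T>_def by blast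
  have cptG: "compactin X G"
    unfolding G_eq
  proof (intro compactin_Un)
    show "compactin X (\<Union>\<T>)"
      using finT cloT compact by (intro compactin_Union) (auto intro: closedin_compact_space)
    have "compactin X (\<gamma> C ` {0..1})" if "C \<in> J" for C
      using edge_path(1)[OF that] unfolding pathin_def
      by (rule image_compactin[rotated]) (simp add: compactin_subtopology)
    then show "compactin X (\<Union>C\<in>J. \<gamma> C ` {0..1})"
      using finJ by (intro compactin_Union) auto
  qed
  have Gtop: "G \<subseteq> topspace X" using cptG compactin_subset_topspace by blast
  let ?Y = "subtopology X G"
  have topY: "topspace ?Y = G" using Gtop by auto
  \<comment> \<open>the fibres of the restricted quotient map are the trees and single points\<close>
  have fibre: "x = y \<or> (\<exists>S\<in>\<T>. x \<in> S \<and> y \<in> S)" if xy: "x \<in> G" "y \<in> G" "lc x = lc y" for x y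
  proof -
    have crit_case: "z \<in> T (lc k)" if zk: "z \<in> G" "k \<in> Cr A f" "lc z = lc k" for z k
    proof (cases "z \<in> \<Union>\<T>")
      case True
      then obtain k' where k': "k' \<in> Cr A f" "z \<in> T (lc k')" by (auto simp: \<T>_def)
      then show ?thesis using T_lc[OF k'] zk(3) by simp
    next
      case False
      then obtain C u where C: "C \<in> J" "u \<in> {0..1}" "z = \<gamma> C u" using zk(1) G_eq by auto
      have "u \<noteq> 0" "u \<noteq> 1" using False crit_T edge_path(2,3)[OF C(1)] C(3) by auto
      then have "z \<in> C" using edge_path(4)[OF C(1)] C by auto
      then have "lc z \<inter> Cr A f = {}" using J_edge(2)[OF C(1)] by blast
      moreover have "k \<in> lc z" using self zk(2,3) crit_subset by auto
      ultimately show ?thesis using zk(2) by blast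
    qed
    show ?thesis
    proof (cases "\<exists>k\<in>Cr A f. lc x = lc k")
      case True
      then obtain k where "k \<in> Cr A f" "lc x = lc k" by blast
      then show ?thesis using crit_case[of x k] crit_case[of y k] xy by (auto simp: \<T>_def)
    next
      case False
      have arc: "\<exists>C u. C \<in> J \<and> u \<in> {0<..<1} \<and> z = \<gamma> C u \<and> z \<in> C" if z: "z \<in> G" "lc z = lc x" for z
      proof -
        have "z \<notin> \<Union>\<T>"
        proof
          assume "z \<in> \<Union>\<T>"
          then obtain k where "k \<in> Cr A f" "z \<in> T (lc k)" unfolding \<T>_def by blast
          then show False using T_lc[of k z] False z(2) by metis
        qed
        then obtain C u where C: "C \<in> J" "u \<in> {0..1}" "z = \<gamma> C u" using z(1) G_eq by auto
        have "u \<noteq> 0" "u \<noteq> 1" using \<open>z \<notin> \<Union>\<T>\<close> crit_T edge_path(2,3)[OF C(1)] C(3) by auto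
        then have "u \<in> {0<..<1}" using C(2) by auto
        then show ?thesis using C edge_path(4)[OF C(1)] by blast
      qed
      obtain C u where C: "C \<in> J" "u \<in> {0<..<1}" "x = \<gamma> C u" "x \<in> C" using arc[of x] xy by blast
      obtain D v where D: "D \<in> J" "v \<in> {0<..<1}" "y = \<gamma> D v" "y \<in> D" using arc[of y] xy by metis
      have "y \<in> lc x" using self[of y] xy Gtop by auto
      have "y \<in> C"
        using tube_lc[OF tube_edge(1)[OF J_edge(1,2)[OF C(1,4)]] tube_edge(2)[OF J_edge(1,2)[OF C(1,4)]]]
          \<open>y \<in> lc x\<close> J_edge(3)[OF C(1,4)] by blast
      then have "D = C" using J_edge(3)[OF C(1)] J_edge(3)[OF D(1,4)] by blast
      have "(f \<circ> \<gamma> C) u = (f \<circ> \<gamma> C) v"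
        using lc_sub[OF \<open>y \<in> lc x\<close>] C(3) D(3) \<open>D = C\<close> by simp
      then have "u = v" using inj_onD[OF inj[OF C(1)], of u v] C(2) D(2) by auto
      then show ?thesis using C(3) D(3) \<open>D = C\<close> by simp
    qed
  qed
  obtain H where H: "continuous_map (prod_topology (top_of_set {0..1::real}) ?Y) ?Y H"
    and H0: "\<And>x. x \<in> topspace ?Y \<Longrightarrow> H (0, x) = x"
    and HT: "\<And>S t x. S \<in> \<T> \<Longrightarrow> t \<in> {0..1} \<Longrightarrow> x \<in> S \<Longrightarrow> H (t, x) \<in> S"
    and H1: "\<And>S x y. S \<in> \<T> \<Longrightarrow> x \<in> S \<Longrightarrow> y \<in> S \<Longrightarrow> H (1, x) = H (1, y)"
  proof (rule collapse_homotopy[of ?Y \<T> J \<gamma>])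
    show "Hausdorff_space ?Y" using hausdorff by (simp add: Hausdorff_space_subtopology)
    show "finite \<T>" "finite J" by (fact finT finJ)+
    show "closedin ?Y S" if "S \<in> \<T>" for S
      using cloT[OF that] that G_eq by (intro closedin_subset_topspace) auto
    show "S = S'" if S: "S \<in> \<T>" "S' \<in> \<T>" "x \<in> S" "x \<in> S'" for S S' x
    proof -
      obtain k k' where "k \<in> Cr A f" "S = T (lc k)" "k' \<in> Cr A f" "S' = T (lc k')"
        using S by (auto simp: \<T>_def)
      then show ?thesis using T_lc[of k x] T_lc[of k' x] S by simp
    qed
    show "contractible_space (subtopology ?Y S)" if "S \<in> \<T>" for S
    proof -
      have "S \<subseteq> G" using that G_eq by blast
      then have "subtopology ?Y S = subtopology X S" by (simp add: subtopology_subtopology Int_absorb1)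
      then show ?thesis using Tprop(3) that by (auto simp: \<T>_def)
    qed
    show "pathin ?Y (\<gamma> C)" if "C \<in> J" for C
      using edge_path(1)[OF that] that G_eq by (auto simp: pathin_subtopology)
    show "inj_on (\<gamma> C) {0..1}" if "C \<in> J" for C
      using inj[OF that] by (rule inj_on_imageI2)
    show "\<gamma> C 0 \<in> \<Union>\<T>" "\<gamma> C 1 \<in> \<Union>\<T>" if "C \<in> J" for C
      using edge_path(2,3)[OF that] crit_T by blast+
    show "\<gamma> C u \<notin> \<Union>\<T>" if "C \<in> J" "u \<in> {0<..<1}" for C u
      using J_disj[OF that(1)] edge_path(4)[OF that(1)] that(2) by blast
    show "C = D" if "C \<in> J" "D \<in> J" "u \<in> {0<..<1}" "v \<in> {0<..<1}" "\<gamma> C u = \<gamma> D v" for C D u v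
    proof -
      have "\<gamma> C u \<in> C" "\<gamma> C u \<in> D"
        using subsetD[OF edge_path(4)[OF that(1)] imageI[OF that(3)]]
          subsetD[OF edge_path(4)[OF that(2)] imageI[OF that(4)]] that(5) by simp_all
      then show ?thesis using J_edge(3)[OF that(1)] J_edge(3)[OF that(2)] by blast
    qed
    show "topspace ?Y = \<Union>\<T> \<union> (\<Union>C\<in>J. \<gamma> C ` {0..1})" using topY G_eq by simp
  qed (rule that)
  show ?thesis
  proof (rule homotopy_equivalent_space_quotient[of ?Y "reeb_graph X f" lc H])
    show "compact_space ?Y" using cptG by (simp add: compact_space_subtopology)
    show "Hausdorff_space (reeb_graph X f)" by (rule Hausdorff_reeb_graph)
    show "continuous_map ?Y (reeb_graph X f) lc"
      using quotient_map_reeb_graph quotient_imp_continuous_map continuous_map_from_subtopology by blast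
    show "lc ` topspace ?Y = topspace (reeb_graph X f)"
    proof
      show "lc ` topspace ?Y \<subseteq> topspace (reeb_graph X f)"
        unfolding topspace_reeb_graph topY using Gtop by blast
      show "topspace (reeb_graph X f) \<subseteq> lc ` topspace ?Y"
        unfolding topspace_reeb_graph topY
      proof
        fix a assume "a \<in> lc ` topspace X"
        then obtain x where x: "x \<in> topspace X" "a = lc x" by blast
        show "a \<in> lc ` G"
        proof (cases "lc x \<inter> Cr A f = {}")
          case True
          then have "edge x \<in> J" using type_IIa_edge[OF x(1)] by (auto simp: J_def)
          moreover have "x \<in> edge x" using tube_edge(2)[OF x(1) True] .
          ultimately obtain u where u: "u \<in> {0<..<1}" "lc (\<gamma> (edge x) u) = lc x"
            using edge_path(6) by blast
          have "u \<in> {0..1}" using u(1) by simp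
          then have "\<gamma> (edge x) u \<in> G" using \<open>edge x \<in> J\<close> G_eq by blast
          then show ?thesis using x(2) u(2) by (metis imageI)
        next
          case False
          then obtain k where k: "k \<in> lc x" "k \<in> Cr A f" by blast
          then have "lc k = lc x" by (simp add: level_component_eq)
          moreover have "k \<in> G" using k(2) crit_T G_eq by blast
          ultimately show ?thesis using x(2) by (metis imageI)
        qed
      qed
    qed
    show "H (1, x) = H (1, y)" if "x \<in> topspace ?Y" "y \<in> topspace ?Y" "lc x = lc y" for x y
      using fibre[of x y] H1 that topY by blast
    show "lc (H (t, x)) = lc (H (t, y))"
      if t: "t \<in> {0..1}" and xy: "x \<in> topspace ?Y" "y \<in> topspace ?Y" "lc x = lc y" for t x y
    proof -
      have "x = y \<or> (\<exists>S\<in>\<T>. x \<in> S \<and> y \<in> S)" using fibre xy topY by blast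
      then show ?thesis
      proof
        assume "\<exists>S\<in>\<T>. x \<in> S \<and> y \<in> S"
        then obtain S where S: "S \<in> \<T>" "x \<in> S" "y \<in> S" by blast
        then obtain k where k: "k \<in> Cr A f" "S = T (lc k)" by (auto simp: \<T>_def)
        then show ?thesis using T_lc[OF k(1)] HT[OF S(1) t] S by metis
      qed simp
    qed
  qed (use H H0 in auto)
qed

end

theorem corollary4p7:
  fixes X :: "'a topology"
    and A :: "('a set \<times> ('a \<Rightarrow> 'b::euclidean_space)) set"
    and f :: "'a \<Rightarrow> real"
    and G :: "'a set"
  assumes "closed_C1_manifold X A"
    and "connected_space X"
    and "DIM('b) \<ge> 2"
    and "C1_function A f"
    and "isolated_critical_points X A f"
    and "is_Gamma X A f G"
  shows "(subtopology X G) homotopy_equivalent_space (reeb_graph X f)"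
proof -
  have X: "Hausdorff_space X" "compact_space X" "C1_atlas X A"
    using assms(1) by (auto simp: closed_C1_manifold_def)
  interpret finite_critical X A f
  proof
    show "Hausdorff_space X" "compact_space X" by (fact X)+
    show "continuous_map X euclideanreal f" by (rule continuous_map_C1_function[OF X(3) assms(4)])
    show "Cr A f \<subseteq> topspace X" using closedin_subset[OF closedin_Cr[OF X(3) assms(4)]] .
    show "finite (Cr A f)" by (rule finite_Cr[OF X(2,3) assms(4,5)])
    show "regular_point X f x" if "x \<in> topspace X - Cr A f" for x
      using that by (intro regular_point_noncritical[OF X(3) assms(4)]) auto
  qed
  show ?thesis by (rule Gamma_homotopy_equivalent_reeb_graph[OF assms(6)])
qed

end
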